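(* Let $n=p_1^{\alpha_1}\cdots p_r^{\alpha_r}$ be the prime factorization of $n$ with all $p_i\ge3$, let $D_n=\langle a,b\mid a^n=b^2=1,\ bab=a^{-1}\rangle$, and let $S=S_1\cup S_2\subseteq D_n\setminus\{1\}$ with $S=S^{-1}$, $S_1\subseteq\langle a\rangle$, $S_2\subseteq b\langle a\rangle$. Suppose $S_2^2$ is $2$-integral. Then $X(D_n,S)$ is integral if and only if $S_1\in B(\langle a\rangle)$ and $S_2=ba^j\langle a^{n/p_i}\rangle\setminus\{ba^{kn/p_i+j}\}$ or $S_2=ba^j\langle a^{n/p_i}\rangle$ for some $1\le i\le r$, $0\le k\le p_i-1$ and $0\le j\le\frac{n}{p_i}-1$.
   Context: The Cayley graph $X(G,S)$ has vertex set $G$, $x,y$ adjacent iff $x^{-1}y\in S$; it is integral if all adjacency eigenvalues are integers. $S_2^2$ is the multiset $\{xy:x,y\in S_2\}$ (ordered pairs). An atom of $\langle a\rangle$ is $[g]=\{x\in\langle a\rangle:\langle x\rangle=\langle g\rangle\}$; $m*[g]$ means each element of $[g]$ with multiplicity $m$. $S_2^2$ is called $2$-integral if $S_2^2=t*\{1\}\cup m_2*[a^{d_2}]$ where $t=|S_2|$, $d_2$ is a divisor of $n$ with $d_2\neq n$, and $m_2\ge1$. $B(\langle a\rangle)$ is the Boolean algebra of subsets of $\langle a\rangle$ generated by its subgroups under finite unions, intersections and complements; equivalently, unions of atoms. *)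

theory Defs
  imports
    "HOL-Algebra.Generated_Groups"
    "HOL-Library.Multiset"
    "Graph_Theory.Pair_Digraph"
    "Jordan_Normal_Form.Char_Poly"
begin

text \<open>The dihedral group \<open>\<langle>a, b | a\<^sup>n = b\<^sup>2 = 1, bab = a\<^sup>-\<^sup>1\<rangle>\<close>: a group generated by \<open>a\<close> and \<open>b\<close> that
  satisfies the relations and has \<open>2n\<close> elements. The cardinality excludes the proper quotients.
  For \<open>n > 0\<close> the lemmas \<open>presentation\<close> and \<open>dihedral_group_exists\<close> below show that this is the
  group given by the presentation.\<close>

locale dihedral_group = group D for D (structure) +
  fixes n :: nat and a b
  assumes a_closed: "a \<in> carrier D"
    and b_closed: "b \<in> carrier D"
    and a_pow_n: "a [^] n = \<one>"
    and b_pow_2: "b [^] (2::nat) = \<one>"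
    and b_a_b: "b \<otimes> a \<otimes> b = inv a"
    and generated: "carrier D = generate D {a, b}"
    and card_carrier: "card (carrier D) = 2 * n"

lemma (in group) dihedral_relations_swap:
  assumes x: "x \<in> carrier G" and y: "y \<in> carrier G"
    and y2: "y [^] (2::nat) = \<one>" and yxy: "y \<otimes> x \<otimes> y = inv x"
  shows "y \<otimes> x [^] (i::int) = x [^] (- i) \<otimes> y"
proof -
  have yy: "y \<otimes> y = \<one>"
    using y2 y by (simp add: numeral_2_eq_2)
  then have inv_y: "inv y = y"
    using y by (simp add: inv_equality)
  have hom: "(\<lambda>z. y \<otimes> z \<otimes> y) \<in> hom G G"
  proof (rule homI)
    fix u v assume u: "u \<in> carrier G" and v: "v \<in> carrier G"
    have "y \<otimes> u \<otimes> y \<otimes> (y \<otimes> v \<otimes> y) = y \<otimes> u \<otimes> (y \<otimes> y) \<otimes> v \<otimes> y"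
      using y u v by (simp add: m_assoc del: yy)
    then show "y \<otimes> (u \<otimes> v) \<otimes> y = y \<otimes> u \<otimes> y \<otimes> (y \<otimes> v \<otimes> y)"
      using yy y u v by (simp add: m_assoc)
  qed (use y in simp)
  interpret c: group_hom G G "\<lambda>z. y \<otimes> z \<otimes> y"
    by unfold_locales (rule hom)
  have "y \<otimes> x [^] i \<otimes> y = (inv x) [^] i"
    using c.hom_int_pow[of x i] x yxy by simp
  also have "\<dots> = x [^] (- i)"
    using x by (simp add: int_pow_inv int_pow_neg)
  finally have "y \<otimes> x [^] i \<otimes> y \<otimes> y = x [^] (- i) \<otimes> y" by simp
  then show ?thesis using x y yy by (simp add: m_assoc)
qed

lemma (in group) dihedral_relations_mult:
  assumes x: "x \<in> carrier G" and y: "y \<in> carrier G"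
    and y2: "y [^] (2::nat) = \<one>" and yxy: "y \<otimes> x \<otimes> y = inv x"
  shows "(x [^] (i::int) \<otimes> (if e then y else \<one>)) \<otimes> (x [^] (j::int) \<otimes> (if f then y else \<one>))
    = x [^] (if e then i - j else i + j) \<otimes> (if e \<noteq> f then y else \<one>)"
proof -
  note swap = dihedral_relations_swap[OF assms]
  have yy: "y \<otimes> y = \<one>"
    using y2 y by (simp add: numeral_2_eq_2)
  have *: "x [^] i \<otimes> y \<otimes> (x [^] j \<otimes> z) = x [^] (i - j) \<otimes> (y \<otimes> z)" if z: "z \<in> carrier G" for z
  proof -
    have "x [^] i \<otimes> y \<otimes> (x [^] j \<otimes> z) = x [^] i \<otimes> (y \<otimes> x [^] j) \<otimes> z"
      using x y z by (simp add: m_assoc)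
    also have "\<dots> = (x [^] i \<otimes> x [^] (- j)) \<otimes> (y \<otimes> z)"
      unfolding swap using x y z by (simp add: m_assoc)
    also have "x [^] i \<otimes> x [^] (- j) = x [^] (i - j)"
      using x int_pow_mult[of x i "- j"] by simp
    finally show ?thesis .
  qed
  show ?thesis
  proof (cases e)
    case True
    then show ?thesis using *[of "if f then y else \<one>"] x y yy by auto
  next
    case False
    then show ?thesis using x y int_pow_mult[of x i j] by (auto simp: m_assoc[symmetric])
  qed
qed

lemma (in group) int_pow_mod:
  assumes x: "x \<in> carrier G" and xn: "x [^] (n::nat) = \<one>"
  shows "x [^] (i mod int n) = x [^] (i :: int)"
proof -
  have "x [^] (int n * (i div int n)) = \<one>"
    using x xn int_pow_pow[of x "int n" "i div int n"] by (simp add: int_pow_int mult.commute)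
  then have "x [^] i = x [^] (i mod int n)"
    using x int_pow_mult[of x "int n * (i div int n)" "i mod int n"] by simp
  then show ?thesis ..
qed

context dihedral_group
begin

lemma bij_betw_normal_form:
  assumes "n > 0"
  shows "bij_betw (\<lambda>(i, e). a [^] (i::int) \<otimes> (if e then b else \<one>))
    ({0..<int n} \<times> UNIV) (carrier D)" (is "bij_betw ?f ?A _")
proof -
  note mult = dihedral_relations_mult[OF a_closed b_closed b_pow_2 b_a_b]
  have mod: "a [^] (i mod int n) = a [^] i" for i
    by (rule int_pow_mod[OF a_closed a_pow_n])
  have f_mod: "?f (i mod int n, e) = ?f (i, e)" for i e by (simp add: mod)
  have in_A: "(i mod int n, e) \<in> ?A" for i and e :: bool using assms by simp
  have mem: "?f (i, e) \<in> ?f ` ?A" for i e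
  proof (rule image_eqI)
    show "?f (i, e) = ?f (i mod int n, e)" by (rule f_mod[symmetric])
  qed (rule in_A)
  have cl: "?f (i, e) \<in> carrier D" for i e using a_closed b_closed by simp
  have inv_b: "inv b = b"
    using b_pow_2 b_closed by (intro inv_equality) (simp_all add: numeral_2_eq_2)
  have gens: "a \<in> ?f ` ?A" "b \<in> ?f ` ?A" "inv a \<in> ?f ` ?A"
    using mem[of 1 False] mem[of 0 True] mem[of "-1" False] a_closed b_closed
    by (simp_all add: int_pow_neg)
  have "generate D {a, b} \<subseteq> ?f ` ?A"
  proof
    fix z assume "z \<in> generate D {a, b}"
    then show "z \<in> ?f ` ?A"
    proof (induction rule: generate.induct)
      case one
      then show ?case using mem[of 0 False] by simp
    next
      case (incl h)
      then show ?case using gens by blast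
    next
      case (inv h)
      then consider "h = a" | "h = b" by blast
      then show ?case using gens inv_b by cases (simp_all only:)
    next
      case (eng u v)
      then obtain i e j f where "u = ?f (i, e)" "v = ?f (j, f)" by auto
      then have "u \<otimes> v = ?f (if e then i - j else i + j, e \<noteq> f)" using mult by simp
      then show ?case using mem by (simp only:)
    qed
  qed
  then have surj: "?f ` ?A = carrier D" using generated cl by auto
  moreover have "card ?A = card (carrier D)"
    by (simp add: card_carrier card_cartesian_product)
  ultimately have "inj_on ?f ?A" by (intro eq_card_imp_inj_on) auto
  then show ?thesis using surj by (simp add: bij_betw_def)
qed

text \<open>The universal property of the presentation.\<close>

lemma presentation:
  fixes H (structure)
  assumes "n > 0" and "group H" and x: "x \<in> carrier H" and y: "y \<in> carrier H"
    and xn: "x [^]\<^bsub>H\<^esub> n = \<one>\<^bsub>H\<^esub>" and y2: "y [^]\<^bsub>H\<^esub> (2::nat) = \<one>\<^bsub>H\<^esub>"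
    and yxy: "y \<otimes>\<^bsub>H\<^esub> x \<otimes>\<^bsub>H\<^esub> y = inv\<^bsub>H\<^esub> x"
  shows "\<exists>h \<in> hom D H. h a = x \<and> h b = y"
proof -
  interpret H: group H by fact
  let ?A = "{0..<int n} \<times> (UNIV :: bool set)"
  define f where "f = (\<lambda>(i, e). a [^] (i::int) \<otimes> (if e then b else \<one>))"
  define g where "g = (\<lambda>(i, e). x [^]\<^bsub>H\<^esub> (i::int) \<otimes>\<^bsub>H\<^esub> (if e then y else \<one>\<^bsub>H\<^esub>))"
  define h where "h z = g (the_inv_into ?A f z)" for z
  have bij: "bij_betw f ?A (carrier D)"
    using bij_betw_normal_form[OF assms(1)] by (simp add: f_def)
  have f_surj: "\<exists>i e. u = f (i, e)" if "u \<in> carrier D" for u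
    using bij that unfolding bij_betw_def by (metis imageE surj_pair)
  have h_f: "h (f (i, e)) = g (i, e)" for i e
  proof -
    have "f (i, e) = f (i mod int n, e)"
      by (simp add: f_def int_pow_mod[OF a_closed a_pow_n])
    then have "h (f (i, e)) = g (i mod int n, e)"
      using bij assms(1) by (simp add: h_def bij_betw_def the_inv_into_f_f)
    then show ?thesis by (simp add: g_def H.int_pow_mod[OF x xn])
  qed
  have "h \<in> hom D H"
  proof (rule homI)
    fix u assume "u \<in> carrier D"
    then obtain i e where "u = f (i, e)" using f_surj by blast
    then show "h u \<in> carrier H" using x y by (simp add: h_f) (simp add: g_def)
  next
    fix u v assume "u \<in> carrier D" and "v \<in> carrier D"
    then obtain i e j k where uv: "u = f (i, e)" "v = f (j, k)"
      using f_surj by metis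
    have "u \<otimes> v = f (if e then i - j else i + j, e \<noteq> k)"
      using dihedral_relations_mult[OF a_closed b_closed b_pow_2 b_a_b] by (simp add: uv f_def)
    then show "h (u \<otimes> v) = h u \<otimes>\<^bsub>H\<^esub> h v"
      by (simp only: uv h_f) (simp only: g_def prod.case H.dihedral_relations_mult[OF x y y2 yxy])
  qed
  moreover have "h a = x"
    using h_f[of 1 False] a_closed x by (simp add: f_def g_def)
  moreover have "h b = y"
    using h_f[of 0 True] b_closed y by (simp add: f_def g_def)
  ultimately show ?thesis by blast
qed

end

lemma dihedral_group_exists:
  assumes "n > 0"
  shows "\<exists>(D :: (int \<times> bool) monoid) a b. dihedral_group D n a b"
proof -
  define D :: "(int \<times> bool) monoid" where
    "D = \<lparr>carrier = {0..<int n} \<times> UNIV,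
      monoid.mult = (\<lambda>(i, e) (j, f). ((if e then i - j else i + j) mod int n, e \<noteq> f)), one = (0, False)\<rparr>"
  have simps: "carrier D = {0..<int n} \<times> UNIV" "\<one>\<^bsub>D\<^esub> = (0, False)"
    "(i, e) \<otimes>\<^bsub>D\<^esub> (j, f) = ((if e then i - j else i + j) mod int n, e \<noteq> f)" for i e j f
    by (simp_all add: D_def)
  interpret group D
  proof (rule groupI)
    fix u assume u: "u \<in> carrier D"
    obtain i e where ie: "u = (i, e)" by fastforce
    show "\<exists>v \<in> carrier D. v \<otimes>\<^bsub>D\<^esub> u = \<one>\<^bsub>D\<^esub>"
      using u assms by (intro bexI[of _ "(if e then i else (- i) mod int n, e)"])
        (auto simp: ie simps mod_simps)
  next
    fix u v w :: "int \<times> bool"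
    obtain i e j f k g where uvw: "u = (i, e)" "v = (j, f)" "w = (k, g)" by (metis surj_pair)
    show "u \<otimes>\<^bsub>D\<^esub> v \<otimes>\<^bsub>D\<^esub> w = u \<otimes>\<^bsub>D\<^esub> (v \<otimes>\<^bsub>D\<^esub> w)"
      by (cases e; cases f; cases g) (simp_all add: uvw simps mod_simps ac_simps diff_diff_eq diff_diff_eq2 diff_add_eq add_diff_eq)
  qed (use assms in \<open>auto simp: simps\<close>)
  have pow: "(1 mod int n, False) [^]\<^bsub>D\<^esub> (k::nat) = (int k mod int n, False)" for k
    by (induction k) (simp_all add: simps mod_simps add.commute)
  let ?a = "(1 mod int n, False)" and ?b = "(0, True)"
  have ab: "?a \<in> carrier D" "?b \<in> carrier D" using assms by (auto simp: simps)
  have "dihedral_group D n ?a ?b"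
  proof
    show "?a [^]\<^bsub>D\<^esub> n = \<one>\<^bsub>D\<^esub>" by (simp add: pow simps)
    show "?b [^]\<^bsub>D\<^esub> (2::nat) = \<one>\<^bsub>D\<^esub>" by (simp add: simps numeral_2_eq_2)
    show "?b \<otimes>\<^bsub>D\<^esub> ?a \<otimes>\<^bsub>D\<^esub> ?b = inv\<^bsub>D\<^esub> ?a"
      using ab by (intro inv_equality[symmetric]) (auto simp: simps mod_simps)
    show "card (carrier D) = 2 * n" by (simp add: simps card_cartesian_product)
    show "carrier D = generate D {?a, ?b}"
    proof
      show "generate D {?a, ?b} \<subseteq> carrier D" using ab by (intro generate_incl) auto
      show "carrier D \<subseteq> generate D {?a, ?b}"
      proof
        fix u assume u: "u \<in> carrier D"
        obtain i e where ie: "u = (i, e)" by fastforce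
        have pw: "?a [^]\<^bsub>D\<^esub> (k::nat) \<in> generate D {?a, ?b}" for k
          by (induction k) (auto intro: generate.intros)
        have "(i, False) \<in> generate D {?a, ?b}"
          using pw[of "nat i"] u by (simp add: pow ie simps)
        moreover have "(i, True) = (i, False) \<otimes>\<^bsub>D\<^esub> ?b" using u by (simp add: simps ie)
        moreover have "?b \<in> generate D {?a, ?b}" by (auto intro: generate.incl)
        ultimately show "u \<in> generate D {?a, ?b}"
          unfolding ie by (cases e) (auto intro: generate.eng)
      qed
    qed
  qed (use ab in auto)
  then show ?thesis by blast
qed

definition cayley_graph :: "('a, 'b) monoid_scheme \<Rightarrow> 'a set \<Rightarrow> 'a pair_pre_digraph" where
  "cayley_graph G S = \<lparr>pverts = carrier G,
    parcs = {(x, y). x \<in> carrier G \<and> y \<in> carrier G \<and> inv\<^bsub>G\<^esub> x \<otimes>\<^bsub>G\<^esub> y \<in> S}\<rparr>"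

definition adjacency_matrix :: "'v pair_pre_digraph \<Rightarrow> 'v list \<Rightarrow> complex mat" where
  "adjacency_matrix \<Gamma> vs =
    mat (length vs) (length vs) (\<lambda>(i, j). if (vs ! i, vs ! j) \<in> parcs \<Gamma> then 1 else 0)"

text \<open>The choice of the enumeration \<open>vs\<close> of the vertices does not affect the eigenvalues.\<close>

definition integral_graph :: "'v pair_pre_digraph \<Rightarrow> bool" where
  "integral_graph \<Gamma> \<longleftrightarrow> finite (pverts \<Gamma>) \<and>
    (\<forall>vs. distinct vs \<and> set vs = pverts \<Gamma> \<longrightarrow>
      (\<forall>k. eigenvalue (adjacency_matrix \<Gamma> vs) k \<longrightarrow> k \<in> \<int>))"

text \<open>The atom \<open>[g]\<close> of \<open>\<langle>a\<rangle>\<close>.\<close>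

definition atom :: "('a, 'b) monoid_scheme \<Rightarrow> 'a \<Rightarrow> 'a \<Rightarrow> 'a set" where
  "atom G a g = {x \<in> generate G {a}. generate G {x} = generate G {g}}"

text \<open>The Boolean algebra \<open>B(\<langle>a\<rangle>)\<close>; complements are taken in \<open>\<langle>a\<rangle>\<close>.\<close>

inductive_set subgroup_algebra :: "('a, 'b) monoid_scheme \<Rightarrow> 'a \<Rightarrow> 'a set set"
  for G :: "('a, 'b) monoid_scheme" and a :: 'a where
  subgroup: "subgroup K G \<Longrightarrow> K \<subseteq> generate G {a} \<Longrightarrow> K \<in> subgroup_algebra G a"
| union: "A \<in> subgroup_algebra G a \<Longrightarrow> B \<in> subgroup_algebra G a \<Longrightarrow> A \<union> B \<in> subgroup_algebra G a"
| inter: "A \<in> subgroup_algebra G a \<Longrightarrow> B \<in> subgroup_algebra G a \<Longrightarrow> A \<inter> B \<in> subgroup_algebra G a"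
| complement: "A \<in> subgroup_algebra G a \<Longrightarrow> generate G {a} - A \<in> subgroup_algebra G a"

text \<open>The multiset \<open>T\<^sup>2\<close> of the products of ordered pairs, for a finite set \<open>T\<close>.\<close>

definition square_mset :: "('a, 'b) monoid_scheme \<Rightarrow> 'a set \<Rightarrow> 'a multiset" where
  "square_mset G T = image_mset (\<lambda>(x, y). x \<otimes>\<^bsub>G\<^esub> y) (mset_set (T \<times> T))"

text \<open>The two multisets on the right-hand side have disjoint supports when \<open>a\<close> has order \<open>n\<close>
  (since \<open>d \<noteq> n\<close>), so their sum is also their union.\<close>

definition two_integral :: "('a, 'b) monoid_scheme \<Rightarrow> nat \<Rightarrow> 'a \<Rightarrow> 'a set \<Rightarrow> bool" where
  "two_integral G n a T \<longleftrightarrow> (\<exists>d m. d dvd n \<and> d \<noteq> n \<and> 1 \<le> m \<and>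
    square_mset G T = replicate_mset (card T) \<one>\<^bsub>G\<^esub>
      + repeat_mset m (mset_set (atom G a (a [^]\<^bsub>G\<^esub> d))))"

end

theory Submission
  imports Defs "HOL-Number_Theory.Residues"
begin

text \<open>Write \<open>e(k) = exp(2\<pi>ik/n)\<close>, \<open>A = {l. a\<^sup>l \<in> S\<^sub>1}\<close> and \<open>T = {t. ba\<^sup>t \<in> S\<^sub>2}\<close>. On the functions
  \<open>a\<^sup>i \<mapsto> \<alpha>e(ji)\<close>, \<open>a\<^sup>ib \<mapsto> \<beta>e(ji)\<close> the adjacency operator is a Hermitian 2 by 2 matrix with eigenvalues
  \<open>c\<^sub>j \<plusminus> |\<tau>\<^sub>j|\<close>, where \<open>c\<^sub>j = \<Sum>\<^bsub>l\<in>A\<^esub> e(jl)\<close> and \<open>\<tau>\<^sub>j = \<Sum>\<^bsub>t\<in>T\<^esub> e(jt)\<close>, and Fourier inversion shows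
  that there are no others.

  If all \<open>2c\<^sub>j\<close> are integers, Fourier inversion writes \<open>2n\<close> times the indicator of \<open>A\<close> as an integer
  combination of characters, and the Frobenius congruence modulo primes \<open>q\<close> prime to \<open>2n\<close> shows that \<open>A\<close>
  is invariant under multiplication by \<open>q\<close>, hence a union of atoms. Conversely Ramanujan sums are integers.

  Let \<open>M = n/d\<close> and \<open>t = |T|\<close>. Distinct elements of \<open>T\<close> differ by \<open>d\<close> times a unit modulo \<open>M\<close>, so
  \<open>t \<le> p\<close> for every prime \<open>p\<close> dividing \<open>M\<close>, while \<open>t(t - 1) = m\<phi>(M)\<close>. Two distinct odd primes dividing
  \<open>M\<close> make \<open>\<phi>(M)\<close> too large; if \<open>p\<^sup>2\<close> divides \<open>M\<close>, then \<open>t = p = |\<tau>\<^sub>1|\<^sup>2\<close> is not a square. So \<open>M = p\<close>, and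
  \<open>|\<tau>\<^sub>1|\<^sup>2 = t - m = s\<^sup>2\<close> gives \<open>t\<^sup>2 - s\<^sup>2 = mp\<close>, whence \<open>p\<close> divides \<open>t - s\<close> or \<open>t + s\<close> and \<open>t\<close> is
  \<open>p\<close> or \<open>p - 1\<close>.\<close>

section \<open>Additive characters and cyclotomic integers\<close>

text \<open>The argument ranges over all integers instead of residues, so that sums and products of
  exponents need no reduction; \<open>root_char_cong\<close> supplies the periodicity.\<close>

definition root_char :: "nat \<Rightarrow> int \<Rightarrow> complex" where
  "root_char n k = cis (2 * pi * of_int k / of_nat n)"

lemma root_char_0 [simp]: "root_char n 0 = 1"
  by (simp add: root_char_def)

lemma root_char_add: "root_char n (k + l) = root_char n k * root_char n l"
  by (simp add: root_char_def cis_mult ring_distribs add_divide_distrib)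

lemma root_char_power: "root_char n k ^ m = root_char n (int m * k)"
  by (induction m) (simp_all add: root_char_add ring_distribs)

lemma cnj_root_char: "cnj (root_char n k) = root_char n (- k)"
  by (simp add: root_char_def cis_cnj)

lemma norm_root_char [simp]: "norm (root_char n k) = 1"
  by (simp add: root_char_def)

lemma root_char_eq_1_iff:
  assumes "n > 0"
  shows "root_char n k = 1 \<longleftrightarrow> int n dvd k"
proof
  assume "root_char n k = 1"
  then have "cos (2 * pi * of_int k / of_nat n) = 1"
    by (simp add: root_char_def complex_eq_iff)
  then obtain m :: int where "2 * pi * of_int k / of_nat n = of_int m * 2 * pi"
    using cos_one_2pi_int by metis
  then have "real_of_int k = of_int (m * int n)"
    using assms by (simp add: field_simps)
  then show "int n dvd k" by (simp only: of_int_eq_iff) simp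
next
  assume "int n dvd k"
  then obtain m where "k = int n * m" by blast
  then have "2 * pi * of_int k / of_nat n = 2 * pi * of_int m"
    using assms by simp
  then show "root_char n k = 1"
    by (simp only: root_char_def cis_multiple_2pi Ints_of_int)
qed

lemma root_char_cong:
  assumes "n > 0" "k mod int n = l mod int n"
  shows "root_char n k = root_char n l"
proof -
  have "root_char n (k - l) = 1"
    using assms by (simp add: root_char_eq_1_iff mod_eq_dvd_iff)
  then show ?thesis using root_char_add[of n "k - l" l] by simp
qed

text \<open>A geometric series: its ratio \<open>root_char n (k * int d)\<close> is an
  \<open>m\<close>-th root of unity, and it is 1 exactly if \<open>m\<close> divides
  \<open>k\<close>. The case \<open>d = 1\<close> is the orthogonality of characters.\<close>

lemma sum_root_char_multiples:
  assumes "n > 0" and n: "n = d * m"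
  shows "(\<Sum>x = 0..<int m. root_char n (k * (int d * x))) = (if int m dvd k then of_nat m else 0)"
proof -
  let ?z = "root_char n (k * int d)"
  have "(\<Sum>x = 0..<int m. root_char n (k * (int d * x))) = (\<Sum>x<m. ?z ^ x)"
    by (rule sum.reindex_bij_witness[of _ int nat]) (auto simp: root_char_power mult_ac)
  moreover have "?z = 1 \<longleftrightarrow> int m dvd k"
    using assms by (auto simp: root_char_eq_1_iff mult.commute)
  moreover have "?z ^ m = 1"
    using assms by (simp add: root_char_power root_char_eq_1_iff)
  ultimately show ?thesis
    by (auto simp: geometric_sum)
qed

lemma sum_root_char:
  assumes "n > 0"
  shows "(\<Sum>i = 0..<int n. root_char n (k * i)) = (if int n dvd k then of_nat n else 0)"
  using sum_root_char_multiples[of n 1 n k] assms by simp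

lemma sum_periodic_shift:
  fixes f :: "int \<Rightarrow> 'a :: comm_monoid_add"
  assumes "n > 0" and "\<And>i. f (i mod int n) = f i"
  shows "(\<Sum>i = 0..<int n. f (i + l)) = (\<Sum>i = 0..<int n. f i)"
  by (rule sum.reindex_bij_witness[of _ "\<lambda>i. (i - l) mod int n" "\<lambda>i. (i + l) mod int n"])
    (use assms in \<open>auto simp: mod_simps\<close>)

text \<open>Interchanging the two sums leaves character sums at \<open>l - i\<close>. These vanish
  unless \<open>n\<close> divides \<open>l - i\<close>, which for two elements of
  \<open>{0..<int n}\<close> means \<open>i = l\<close>.\<close>

lemma fourier_inversion:
  assumes "n > 0" and "l \<in> {0..<int n}"
  shows "(\<Sum>j = 0..<int n. (\<Sum>i = 0..<int n. f i * root_char n (- j * i)) * root_char n (j * l))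
    = of_nat n * f l"
proof -
  have "(\<Sum>j = 0..<int n. (\<Sum>i = 0..<int n. f i * root_char n (- j * i)) * root_char n (j * l))
    = (\<Sum>j = 0..<int n. \<Sum>i = 0..<int n. f i * root_char n ((l - i) * j))"
    by (intro sum.cong refl, unfold sum_distrib_right mult.assoc root_char_add[symmetric])
      (simp add: algebra_simps)
  also have "\<dots> = (\<Sum>i = 0..<int n. f i * (\<Sum>j = 0..<int n. root_char n ((l - i) * j)))"
    by (subst sum.swap) (simp add: sum_distrib_left)
  also have "\<dots> = (\<Sum>i = 0..<int n. if i = l then of_nat n * f i else 0)"
  proof (rule sum.cong)
    fix i assume "i \<in> {0..<int n}"
    then have "int n dvd l - i \<longleftrightarrow> i = l"
      using assms(2) by (auto simp: mod_eq_dvd_iff[symmetric])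
    then show "f i * (\<Sum>j = 0..<int n. root_char n ((l - i) * j)) = (if i = l then of_nat n * f i else 0)"
      using assms(1) by (simp add: sum_root_char)
  qed simp
  also have "\<dots> = of_nat n * f l" using assms by simp
  finally show ?thesis .
qed

section \<open>The ring of cyclotomic integers\<close>

text \<open>The ring is given by a spanning set over the integers: closure under products is then
  inherited from the roots of unity, and multiplication by an element becomes an integer matrix. The
  coefficients \<open>c\<close> are not unique.\<close>

definition cyclotomic_integers :: "nat \<Rightarrow> complex set" where
  "cyclotomic_integers n = range (\<lambda>c. \<Sum>i = 0..<int n. of_int (c i) * root_char n i)"

lemma cyclotomic_integersI:
  "(\<Sum>i = 0..<int n. of_int (c i) * root_char n i) \<in> cyclotomic_integers n"
  unfolding cyclotomic_integers_def by blast

lemma cyclotomic_integersE: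
  assumes "z \<in> cyclotomic_integers n"
  obtains c where "z = (\<Sum>i = 0..<int n. of_int (c i) * root_char n i)"
  using assms unfolding cyclotomic_integers_def by blast

lemma cyclotomic_integers_0: "0 \<in> cyclotomic_integers n"
  using cyclotomic_integersI[of "\<lambda>_. 0" n] by simp

lemma cyclotomic_integers_add:
  assumes "x \<in> cyclotomic_integers n" "y \<in> cyclotomic_integers n"
  shows "x + y \<in> cyclotomic_integers n"
proof -
  obtain c d where "x = (\<Sum>i = 0..<int n. of_int (c i) * root_char n i)"
    "y = (\<Sum>i = 0..<int n. of_int (d i) * root_char n i)"
    using assms by (metis cyclotomic_integersE)
  then show ?thesis using cyclotomic_integersI[of "\<lambda>i. c i + d i" n]
    by (simp add: ring_distribs sum.distrib)
qed

lemma cyclotomic_integers_of_int_mult: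
  assumes "x \<in> cyclotomic_integers n"
  shows "of_int m * x \<in> cyclotomic_integers n"
proof -
  obtain c where "x = (\<Sum>i = 0..<int n. of_int (c i) * root_char n i)"
    using assms by (metis cyclotomic_integersE)
  then show ?thesis using cyclotomic_integersI[of "\<lambda>i. m * c i" n]
    by (simp add: sum_distrib_left mult.assoc)
qed

lemma cyclotomic_integers_sum:
  "(\<And>i. i \<in> I \<Longrightarrow> f i \<in> cyclotomic_integers n) \<Longrightarrow> sum f I \<in> cyclotomic_integers n"
  by (induction I rule: infinite_finite_induct)
    (auto intro: cyclotomic_integers_0 cyclotomic_integers_add)

lemma cyclotomic_integers_root_char:
  assumes "n > 0"
  shows "root_char n k \<in> cyclotomic_integers n"
proof -
  have "(\<Sum>i = 0..<int n. of_int (if i = k mod int n then 1 else 0) * root_char n i)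
    = (\<Sum>i = 0..<int n. if i = k mod int n then root_char n i else 0)"
    by (intro sum.cong) auto
  also have "\<dots> = root_char n (k mod int n)"
    using assms by simp
  also have "\<dots> = root_char n k"
    using assms by (intro root_char_cong) auto
  finally show ?thesis by (metis cyclotomic_integersI)
qed

lemma cyclotomic_integers_1: "n > 0 \<Longrightarrow> 1 \<in> cyclotomic_integers n"
  using cyclotomic_integers_root_char[of n 0] by simp

lemma cyclotomic_integers_mult:
  assumes n: "n > 0" and "x \<in> cyclotomic_integers n" "y \<in> cyclotomic_integers n"
  shows "x * y \<in> cyclotomic_integers n"
proof -
  obtain c d where "x = (\<Sum>i = 0..<int n. of_int (c i) * root_char n i)"
    "y = (\<Sum>i = 0..<int n. of_int (d i) * root_char n i)"
    using assms by (metis cyclotomic_integersE)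
  then have "x * y = (\<Sum>i = 0..<int n. \<Sum>j = 0..<int n. of_int (c i * d j) * root_char n (i + j))"
    by (simp add: sum_product root_char_add mult_ac)
  then show ?thesis
    using n by (simp only:) (intro cyclotomic_integers_sum cyclotomic_integers_of_int_mult
        cyclotomic_integers_root_char)
qed

lemma cyclotomic_integers_power:
  "n > 0 \<Longrightarrow> x \<in> cyclotomic_integers n \<Longrightarrow> x ^ k \<in> cyclotomic_integers n"
  by (induction k) (auto intro: cyclotomic_integers_1 cyclotomic_integers_mult)

text \<open>Multiplication by \<open>z\<close> acts on the powers of the root of unity by an integer circulant matrix,
  whose characteristic polynomial is monic and annihilates \<open>z\<close>.\<close>

lemma cyclotomic_integers_algebraic_int:
  assumes n: "n > 0" and "z \<in> cyclotomic_integers n"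
  shows "algebraic_int z"
proof -
  obtain c where z: "z = (\<Sum>i = 0..<int n. of_int (c i) * root_char n i)"
    using assms by (metis cyclotomic_integersE)
  define A :: "int mat" where "A = mat n n (\<lambda>(i, j). c ((int j - int i) mod int n))"
  define v where "v = vec n (\<lambda>j. root_char n (int j))"
  have A: "A \<in> carrier_mat n n" by (simp add: A_def)
  have "map_mat of_int A *\<^sub>v v = z \<cdot>\<^sub>v v"
  proof (rule eq_vecI)
    fix i assume "i < dim_vec (z \<cdot>\<^sub>v v)"
    then have i: "i < n" by (simp add: v_def)
    let ?f = "\<lambda>k. of_int (c (k mod int n)) * root_char n (k + int i)"
    have f_mod: "?f (k mod int n) = ?f k" for k
      using n by (simp add: root_char_cong[of n "k mod int n + int i" "k + int i"] mod_simps)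
    have "(map_mat of_int A *\<^sub>v v) $ i = (\<Sum>j = 0..<n. of_int (c ((int j - int i) mod int n)) * root_char n (int j))"
      using i by (simp add: A_def v_def scalar_prod_def)
    also have "\<dots> = (\<Sum>j = 0..<int n. ?f (j + (- int i)))"
      by (rule sum.reindex_bij_witness[of _ nat int]) auto
    also have "\<dots> = (\<Sum>k = 0..<int n. ?f k)"
      using n f_mod by (rule sum_periodic_shift[where f = ?f])
    also have "\<dots> = (z \<cdot>\<^sub>v v) $ i"
      using i by (simp add: z v_def root_char_add sum_distrib_right mult.assoc)
    finally show "(map_mat of_int A *\<^sub>v v) $ i = (z \<cdot>\<^sub>v v) $ i" .
  qed (simp add: A_def v_def)
  moreover have "v \<noteq> 0\<^sub>v n"
  proof
    assume "v = 0\<^sub>v n"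
    then have "v $ 0 = 0" using n by simp
    then show False using n by (simp add: v_def)
  qed
  ultimately have "eigenvalue (map_mat of_int A) z"
    unfolding eigenvalue_def eigenvector_def by (intro exI[of _ v]) (simp add: v_def A_def)
  then have "poly (map_poly of_int (char_poly A)) z = 0"
    using A by (simp add: eigenvalue_root_char_poly[of _ n] of_int_hom.char_poly_hom[OF A])
  then show ?thesis
    unfolding algebraic_int_altdef_ipoly using degree_monic_char_poly[OF A] by blast
qed

section \<open>Sets with integral Fourier transform\<close>

text \<open>The inner binomial coefficients are divisible by the prime \<open>q\<close>. Congruence
  modulo \<open>q\<close> in the cyclotomic ring is expressed by a quotient \<open>r\<close> in that
  ring.\<close>

lemma cyclotomic_integers_frobenius_add:
  assumes n: "n > 0" and q: "prime (q::nat)" and x: "x \<in> cyclotomic_integers n" and y: "y \<in> cyclotomic_integers n"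
  shows "\<exists>r \<in> cyclotomic_integers n. (x + y) ^ q - (x ^ q + y ^ q) = of_nat q * r"
proof
  let ?r = "\<Sum>k = 1..<q. of_int (int ((q choose k) div q)) * (x ^ k * y ^ (q - k))"
  show "?r \<in> cyclotomic_integers n"
    using n x y by (intro cyclotomic_integers_sum cyclotomic_integers_of_int_mult
        cyclotomic_integers_mult cyclotomic_integers_power)
  have "q > 0" using q prime_gt_0_nat by blast
  then have split: "{..q} = insert 0 (insert q {1..<q})" by auto
  have "(x + y) ^ q = x ^ q + y ^ q + (\<Sum>k = 1..<q. of_nat (q choose k) * x ^ k * y ^ (q - k))"
    using \<open>q > 0\<close> by (simp add: binomial_ring split)
  also have "(\<Sum>k = 1..<q. of_nat (q choose k) * x ^ k * y ^ (q - k)) = of_nat q * ?r"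
    unfolding sum_distrib_left
  proof (rule sum.cong)
    fix k assume "k \<in> {1..<q}"
    then have "q dvd q choose k"
      using q by (intro dvd_choose_prime) auto
    then have "(of_nat (q choose k) :: complex) = of_nat q * of_nat ((q choose k) div q)"
      by (metis dvd_mult_div_cancel of_nat_mult)
    then show "of_nat (q choose k) * x ^ k * y ^ (q - k)
      = of_nat q * (of_int (int ((q choose k) div q)) * (x ^ k * y ^ (q - k)))"
      by simp
  qed simp
  finally show "(x + y) ^ q - (x ^ q + y ^ q) = of_nat q * ?r" by simp
qed

lemma cyclotomic_integers_frobenius_sum:
  assumes n: "n > 0" and q: "prime (q::nat)" and "finite I" and "\<And>i. i \<in> I \<Longrightarrow> f i \<in> cyclotomic_integers n"
  shows "\<exists>r \<in> cyclotomic_integers n. (\<Sum>i\<in>I. f i) ^ q - (\<Sum>i\<in>I. f i ^ q) = of_nat q * r"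
  using assms(3,4)
proof (induction I rule: finite_induct)
  case empty
  then show ?case
    using q by (intro bexI[OF _ cyclotomic_integers_0]) (simp add: prime_gt_0_nat)
next
  case (insert i I)
  then obtain r where r: "r \<in> cyclotomic_integers n" "(\<Sum>i\<in>I. f i) ^ q - (\<Sum>i\<in>I. f i ^ q) = of_nat q * r"
    by auto
  obtain s where s: "s \<in> cyclotomic_integers n"
    "(f i + (\<Sum>i\<in>I. f i)) ^ q - (f i ^ q + (\<Sum>i\<in>I. f i) ^ q) = of_nat q * s"
    using cyclotomic_integers_frobenius_add[OF n q, of "f i" "\<Sum>i\<in>I. f i"] insert.prems
    by (auto intro: cyclotomic_integers_sum)
  have "(\<Sum>i\<in>insert i I. f i) ^ q - (\<Sum>i\<in>insert i I. f i ^ q)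
    = ((f i + (\<Sum>i\<in>I. f i)) ^ q - (f i ^ q + (\<Sum>i\<in>I. f i) ^ q))
      + ((\<Sum>i\<in>I. f i) ^ q - (\<Sum>i\<in>I. f i ^ q))"
    using insert.hyps by (simp add: algebra_simps)
  also have "\<dots> = of_nat q * (s + r)" using r s by (simp add: ring_distribs)
  finally show ?case using cyclotomic_integers_add[OF s(1) r(1)] by blast
qed

text \<open>The quotient \<open>r\<close> is rational and an algebraic integer, hence an integer. So
  congruences between rational integers descend from the cyclotomic ring.\<close>

lemma cyclotomic_integers_dvd:
  assumes n: "n > 0" and q: "q > 0" and r: "r \<in> cyclotomic_integers n"
    and eq: "of_int a - of_int b = of_nat q * r"
  shows "int q dvd a - b"
proof -
  have r_eq: "r = of_int (a - b) / of_int (int q)" using eq q by (simp add: field_simps)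
  then have "r \<in> \<rat>" by (metis Rats_divide Rats_of_int)
  then obtain m where "r = of_int m"
    using rational_algebraic_int_is_int[OF cyclotomic_integers_algebraic_int[OF n r]]
    by (auto elim: Ints_cases)
  then have "(of_int (a - b) :: complex) = of_int (int q * m)"
    using eq by simp
  then have "a - b = int q * m" by (simp only: of_int_eq_iff)
  then show ?thesis by simp
qed

text \<open>In this form Fermat's theorem includes the multiples of \<open>q\<close>; the residue
  \<open>m\<close> carries it over from the natural numbers.\<close>

lemma fermat_int:
  assumes "prime (q::nat)"
  shows "int q dvd c ^ q - c"
proof -
  define m where "m = nat (c mod int q)"
  have q0: "q > 0" using assms prime_gt_0_nat by blast
  have cm: "[c = int m] (mod int q)"
    using q0 by (simp add: m_def cong_def)
  have "[m ^ q = m] (mod q)"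
  proof (cases "q dvd m")
    case True
    then show ?thesis using q0 by (meson cong_dvd_iff cong_0_iff cong_sym cong_trans dvd_power dvd_trans)
  next
    case False
    then have "[m ^ (q - 1) * m = 1 * m] (mod q)"
      using fermat_theorem[OF assms] cong_scalar_right by blast
    then show ?thesis by (metis power_minus_mult[OF q0] mult_1)
  qed
  then have "[int m ^ q = int m] (mod int q)"
    by (metis cong_int_iff of_nat_power)
  then have "[c ^ q = c] (mod int q)"
    using cm by (meson cong_pow cong_sym cong_trans)
  then show ?thesis by (simp add: cong_iff_dvd_diff)
qed

text \<open>Raising the sum to the power \<open>q\<close> multiplies every exponent by
  \<open>q\<close> and, by Fermat, changes no coefficient modulo \<open>q\<close>. Hence
  \<open>H l ^ q\<close> is congruent to \<open>H (int q * l)\<close>, and Fermat for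
  \<open>H l\<close> removes the power.\<close>

lemma integral_fourier_frobenius:
  assumes n: "n > 0" and q: "prime (q::nat)"
    and H: "\<And>l. (\<Sum>j = 0..<int n. of_int (C j) * root_char n (j * l)) = of_int (H l)"
  shows "int q dvd H (int q * l) - H l"
proof -
  let ?f = "\<lambda>j. of_int (C j) * root_char n (j * l)"
  have q0: "q > 0" using q prime_gt_0_nat by blast
  have "\<And>j. ?f j \<in> cyclotomic_integers n"
    using n by (intro cyclotomic_integers_of_int_mult cyclotomic_integers_root_char)
  then obtain r where r: "r \<in> cyclotomic_integers n"
    "(\<Sum>j = 0..<int n. ?f j) ^ q - (\<Sum>j = 0..<int n. ?f j ^ q) = of_nat q * r"
    using cyclotomic_integers_frobenius_sum[OF n q, of "{0..<int n}" ?f] by auto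
  \<comment> \<open>The Fermat quotients turn the congruences of the coefficients into
    equations.\<close>
  define D where "D j = (C j ^ q - C j) div int q" for j
  have D: "C j ^ q = C j + int q * D j" for j
    using fermat_int[OF q, of "C j"] by (simp add: D_def)
  let ?s = "\<Sum>j = 0..<int n. of_int (D j) * root_char n (j * (int q * l))"
  have s: "?s \<in> cyclotomic_integers n"
    using n by (intro cyclotomic_integers_sum cyclotomic_integers_of_int_mult cyclotomic_integers_root_char)
  have "?f j ^ q = of_int (C j) * root_char n (j * (int q * l))
      + of_nat q * (of_int (D j) * root_char n (j * (int q * l)))" for j
  proof -
    have "?f j ^ q = of_int (C j ^ q) * root_char n (j * (int q * l))"
      by (simp add: power_mult_distrib root_char_power mult_ac)
    also have "\<dots> = of_int (C j + int q * D j) * root_char n (j * (int q * l))"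
      by (simp only: D)
    finally show ?thesis by (simp add: ring_distribs)
  qed
  then have "(\<Sum>j = 0..<int n. ?f j ^ q) = of_int (H (int q * l)) + of_nat q * ?s"
    by (simp add: sum.distrib H sum_distrib_left)
  then have "of_int (H l ^ q) - of_int (H (int q * l)) = of_nat q * (r + ?s)"
    using r(2) H[of l] by (simp add: algebra_simps)
  then have "int q dvd H l ^ q - H (int q * l)"
    using n q0 cyclotomic_integers_add[OF r(1) s] by (rule_tac cyclotomic_integers_dvd)
  moreover have "int q dvd H l ^ q - H l" by (rule fermat_int[OF q])
  ultimately show ?thesis
    using dvd_diff[of "int q" "H l ^ q - H l" "H l ^ q - H (int q * l)"] by simp
qed

section \<open>Residues with the same gcd are unit multiples of each other\<close>

lemma coprime_lift:
  fixes u m N :: nat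
  assumes "coprime u m" and "N > 0"
  shows "\<exists>k. coprime (u + m * k) N"
proof
  \<comment> \<open>Every prime factor of \<open>N\<close> divides exactly one of \<open>u\<close>
    and \<open>m * ?k\<close>: if it divides \<open>u\<close>, it divides neither \<open>m\<close>
    nor \<open>?k\<close>; otherwise it is a factor of \<open>?k\<close>. So it does not divide the
    sum.\<close>
  let ?k = "\<Prod>{p \<in> prime_factors N. \<not> p dvd u}"
  show "coprime (u + m * ?k) N"
  proof (rule ccontr)
    assume "\<not> coprime (u + m * ?k) N"
    then obtain p where p: "prime p" "p dvd u + m * ?k" "p dvd N"
      using prime_factor_nat[of "gcd (u + m * ?k) N"] by (auto simp: coprime_iff_gcd_eq_1)
    show False
    proof (cases "p dvd u")
      case True
      then have "p dvd m * ?k" using p(2) by (simp add: dvd_add_right_iff)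
      moreover have "\<not> p dvd m"
        using True p(1) assms(1) coprime_common_divisor not_prime_unit by blast
      ultimately have "p dvd ?k" using p(1) prime_dvd_mult_iff by blast
      then obtain p' where "p' \<in> prime_factors N" "\<not> p' dvd u" "p dvd p'"
        using p(1) by (subst (asm) prime_dvd_prod_iff) auto
      then show False using p(1) True by (metis in_prime_factors_imp_prime primes_dvd_imp_eq)
    next
      case False
      then have "p dvd ?k"
        using p assms(2) by (intro dvd_prodI) (auto simp: prime_factors_dvd)
      then show False using p(2) False by (simp add: dvd_add_left_iff)
    qed
  qed
qed

text \<open>After division by the common gcd both numbers are units modulo the cofactor
  \<open>m\<close> of \<open>n\<close>, and so is their quotient. It is then lifted to a number
  prime to \<open>N\<close>, which will be \<open>2 * n\<close>.\<close>

lemma gcd_eq_imp_unit_multiple: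
  fixes l l' n N :: nat
  assumes n: "n > 0" and N: "N > 0" and eq: "gcd l n = gcd l' n"
  shows "\<exists>u. coprime u N \<and> [u * l = l'] (mod n)"
proof -
  define g where "g = gcd l n"
  have g: "g > 0" using n by (simp add: g_def)
  obtain x m where xm: "l = x * g" "n = m * g" "coprime x m"
    using gcd_coprime_exists[of l n] n unfolding g_def by auto
  obtain y m' where ym: "l' = y * g" "n = m' * g" "coprime y m'"
    using gcd_coprime_exists[of l' n] n unfolding g_def eq by auto
  have m': "m' = m" using xm ym g by simp
  obtain x' where x': "[x * x' = 1] (mod m)"
    using cong_solve_coprime_nat[OF xm(3)] by auto
  then have "coprime x' m"
    by (metis coprime_iff_invertible_nat mult.commute One_nat_def)
  then have "coprime (y * x') m" using ym(3) m' by simp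
  then obtain k where k: "coprime (y * x' + m * k) N"
    using coprime_lift N by blast
  have "[(y * x' + m * k) * x = y * (x * x')] (mod m)"
    unfolding cong_def by (simp add: ring_distribs mult.assoc mod_add_eq[of "y * (x' * x)", symmetric] mult.commute[of x x'])
  then have "[(y * x' + m * k) * x = y] (mod m)"
    using x' by (metis cong_scalar_left cong_trans mult.right_neutral)
  then have "[(y * x' + m * k) * l = l'] (mod n)"
    unfolding xm ym(1) mult.assoc[symmetric]
    using g by (metis cong_def mult_mod_left)
  then show ?thesis using k by blast
qed

text \<open>The factor 2 appears because integrality is first known only for the sum of the two
  eigenvalues belonging to \<open>j\<close>. By Fourier inversion the integers \<open>C j\<close>
  are the transform of the function \<open>H\<close>, whose only values are 0 and
  \<open>2 * int n\<close>.\<close>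

lemma integral_fourier_imp_gcd_closed:
  assumes n: "n > 0" and A: "A \<subseteq> {0..<int n}"
    and int: "\<And>j. 2 * (\<Sum>l\<in>A. root_char n (j * l)) \<in> \<int>"
    and l: "l \<in> A" and l': "l' \<in> {0..<int n}" and eq: "gcd l (int n) = gcd l' (int n)"
  shows "l' \<in> A"
proof -
  define H :: "int \<Rightarrow> int" where "H l = (if l mod int n \<in> A then 2 * int n else 0)" for l
  obtain C where C: "\<And>j. 2 * (\<Sum>l\<in>A. root_char n (- j * l)) = of_int (C j)"
    using int unfolding Ints_def image_iff by metis
  have H: "(\<Sum>j = 0..<int n. of_int (C j) * root_char n (j * l)) = of_int (H l)" for l
  proof -
    let ?f = "\<lambda>i. if i \<in> A then 1 else 0 :: complex"
    have "(\<Sum>l\<in>A. root_char n (- j * l)) = (\<Sum>i = 0..<int n. ?f i * root_char n (- j * i))" for j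
      using A by (intro sum.mono_neutral_cong_left) auto
    then have C': "of_int (C j) = 2 * (\<Sum>i = 0..<int n. ?f i * root_char n (- j * i))" for j
      using C by metis
    have "(\<Sum>j = 0..<int n. of_int (C j) * root_char n (j * l))
      = (\<Sum>j = 0..<int n. of_int (C j) * root_char n (j * (l mod int n)))"
      using n by (intro sum.cong refl arg_cong2[of _ _ _ _ "(*)"] root_char_cong) (simp_all add: mod_simps)
    also have "\<dots> = 2 * (\<Sum>j = 0..<int n. (\<Sum>i = 0..<int n. ?f i * root_char n (- j * i)) * root_char n (j * (l mod int n)))"
      unfolding C' mult.assoc sum_distrib_left[symmetric] ..
    also have "\<dots> = 2 * (of_nat n * ?f (l mod int n))"
      using n by (subst fourier_inversion) auto
    finally show ?thesis by (simp add: H_def)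
  qed
  \<comment> \<open>Different values of \<open>H\<close> differ by \<open>2 * int n\<close> up to
    sign, so a congruence modulo a prime not dividing \<open>2 * n\<close> is an equality.\<close>
  have step: "(int q * l) mod int n \<in> A \<longleftrightarrow> l mod int n \<in> A" if q: "prime q" "coprime q (2 * n)" for q l
  proof (rule ccontr)
    assume "\<not> ?thesis"
    then have "H (int q * l) - H l = 2 * int n \<or> H (int q * l) - H l = - (2 * int n)"
      by (auto simp: H_def)
    then have "int q dvd int (2 * n)"
      using integral_fourier_frobenius[OF n q(1) H, of l] by auto
    then have "q dvd 2 * n" by (simp only: of_nat_dvd_iff)
    then show False using q by (metis coprime_absorb_left not_prime_unit)
  qed
  \<comment> \<open>Induction over the prime factorization passes from primes to all multipliers
    prime to \<open>2 * n\<close>. This is why the multiplier below is chosen prime to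
    \<open>2 * n\<close>.\<close>
  have unit: "coprime u (2 * n) \<Longrightarrow> (int u * l) mod int n \<in> A \<longleftrightarrow> l mod int n \<in> A" for u l
  proof (induction u arbitrary: l rule: prime_divisors_induct)
    case (factor p x)
    then have "coprime p (2 * n)" "coprime x (2 * n)" by auto
    then show ?case using factor step[of p "int x * l"] by (simp add: mult.assoc)
  qed (use n in auto)
  have "gcd (nat l) n = gcd (nat l') n"
    using eq l l' A by (metis atLeastLessThan_iff gcd_int_int_eq int_nat_eq of_nat_eq_iff subset_eq)
  then obtain u where u: "coprime u (2 * n)" "[u * nat l = nat l'] (mod n)"
    using gcd_eq_imp_unit_multiple[of n "2 * n" "nat l" "nat l'"] n by auto
  then have "(int u * l) mod int n = l'"
    using l l' A by (auto simp flip: cong_int_iff simp: cong_def subset_eq)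
  then show ?thesis using unit[OF u(1), of l] l A by (auto simp: subset_eq)
qed

section \<open>Ramanujan sums\<close>

text \<open>By closure, the part of \<open>A\<close> with a given gcd is a whole gcd class, so the
  character sum over \<open>A\<close> splits into Ramanujan sums.\<close>

lemma gcd_class_sum_integral:
  assumes n: "n > 0" and A: "A \<subseteq> {0..<int n}"
    and closed: "\<And>l l'. l \<in> A \<Longrightarrow> l' \<in> {0..<int n} \<Longrightarrow> gcd l (int n) = gcd l' (int n) \<Longrightarrow> l' \<in> A"
  shows "(\<Sum>l\<in>A. root_char n (j * l))
    = (\<Sum>e \<in> (\<lambda>l. gcd l (int n)) ` A. \<Sum>l | l \<in> {0..<int n} \<and> gcd l (int n) = e. root_char n (j * l))"
proof -
  have "finite A" using A finite_subset by blast
  then have "(\<Sum>l\<in>A. root_char n (j * l))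
    = (\<Sum>e \<in> (\<lambda>l. gcd l (int n)) ` A. \<Sum>l | l \<in> A \<and> gcd l (int n) = e. root_char n (j * l))"
    by (rule sum.image_gen)
  also have "\<dots> = (\<Sum>e \<in> (\<lambda>l. gcd l (int n)) ` A. \<Sum>l | l \<in> {0..<int n} \<and> gcd l (int n) = e. root_char n (j * l))"
  proof (intro sum.cong refl)
    fix e assume "e \<in> (\<lambda>l. gcd l (int n)) ` A"
    then show "{l. l \<in> A \<and> gcd l (int n) = e} = {l. l \<in> {0..<int n} \<and> gcd l (int n) = e}"
      using A closed by auto
  qed
  finally show ?thesis .
qed

text \<open>Induction from large divisors to small ones. The sum over all multiples of
  \<open>d\<close> is a geometric series with integer value, and it splits into the Ramanujan sums
  of divisors that are multiples of \<open>d\<close>; all of these except the one for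
  \<open>d\<close> are integers by induction.\<close>

lemma ramanujan_sum_integral:
  assumes n: "n > 0" and "d dvd n"
  shows "(\<Sum>l | l \<in> {0..<int n} \<and> gcd l (int n) = int d. root_char n (j * l)) \<in> \<int>"
  using assms(2)
proof (induction "n - d" arbitrary: d rule: less_induct)
  case less
  let ?R = "\<lambda>e. \<Sum>l | l \<in> {0..<int n} \<and> gcd l (int n) = e. root_char n (j * l)"
  let ?A = "{l \<in> {0..<int n}. int d dvd l}"
  let ?E = "(\<lambda>l. gcd l (int n)) ` ?A"
  obtain m where m: "n = d * m" using less.prems by blast
  have d0: "d > 0" using n m by simp
  have "(\<Sum>l\<in>?A. root_char n (j * l)) = (\<Sum>x = 0..<int m. root_char n (j * (int d * x)))"
    by (rule sum.reindex_bij_witness[of _ "\<lambda>x. int d * x" "\<lambda>l. l div int d"])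
      (use d0 m in \<open>auto simp: zero_le_mult_iff elim!: dvdE\<close>)
  also have "\<dots> \<in> \<int>" using sum_root_char_multiples[OF n m] by simp
  finally have total: "(\<Sum>l\<in>?A. root_char n (j * l)) \<in> \<int>" .
  have "int d dvd l'" if "int d dvd l" "gcd l (int n) = gcd l' (int n)" for l l'
    using that less.prems by (metis dvd_trans gcd_dvd1 gcd_greatest of_nat_dvd_iff)
  then have eq: "(\<Sum>l\<in>?A. root_char n (j * l)) = (\<Sum>e\<in>?E. ?R e)"
    using n by (intro gcd_class_sum_integral) auto
  have fin: "finite ?E"
    by (rule finite_imageI, rule finite_subset[of _ "{0..<int n}"]) auto
  \<comment> \<open>For \<open>d = n\<close> the class is represented by 0, since \<open>n\<close>
    itself is outside the range of residues.\<close>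
  have mem: "int d \<in> ?E"
  proof (cases "d = n")
    case True
    then show ?thesis using n by (intro image_eqI[of _ _ 0]) auto
  next
    case False
    then have "d < n" using less.prems n by (meson dvd_imp_le nat_less_le)
    then show ?thesis using less.prems d0 by (intro image_eqI[of _ _ "int d"]) (auto simp: gcd_int_int_eq)
  qed
  have "?R e \<in> \<int>" if e: "e \<in> ?E - {int d}" for e
  proof -
    obtain l where l: "int d dvd l" "e = gcd l (int n)" using e by auto
    define e' where "e' = nat e"
    have e': "e = int e'" by (simp add: e'_def l)
    have "e' dvd n" by (metis e' gcd_dvd2 l(2) of_nat_dvd_iff)
    moreover have "d dvd e'" using l less.prems by (metis e' gcd_greatest of_nat_dvd_iff)
    moreover have "e' \<noteq> d" using e e' by auto
    ultimately have "n - e' < n - d"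
      using n by (metis diff_less_mono2 dvd_imp_le dvd_pos_nat nat_less_le order_less_le_trans)
    then show ?thesis using less.hyps[of e'] \<open>e' dvd n\<close> e' by simp
  qed
  then have "(\<Sum>e\<in>?E - {int d}. ?R e) \<in> \<int>" by (rule Ints_sum)
  then have "(\<Sum>l\<in>?A. root_char n (j * l)) - (\<Sum>e\<in>?E - {int d}. ?R e) \<in> \<int>"
    using total by (intro Ints_diff)
  moreover have "(\<Sum>l\<in>?A. root_char n (j * l)) = ?R (int d) + (\<Sum>e\<in>?E - {int d}. ?R e)"
    by (rule trans[OF eq sum.remove[OF fin mem]])
  moreover have "a \<in> \<int>" if "x - r \<in> \<int>" "x = a + r" for a r x :: complex
    using that by simp
  ultimately show ?case by blast
qed

lemma gcd_closed_imp_integral_fourier: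
  assumes n: "n > 0" and A: "A \<subseteq> {0..<int n}"
    and closed: "\<And>l l'. l \<in> A \<Longrightarrow> l' \<in> {0..<int n} \<Longrightarrow> gcd l (int n) = gcd l' (int n) \<Longrightarrow> l' \<in> A"
  shows "(\<Sum>l\<in>A. root_char n (j * l)) \<in> \<int>"
proof -
  have "(\<Sum>l | l \<in> {0..<int n} \<and> gcd l (int n) = e. root_char n (j * l)) \<in> \<int>"
    if "e \<in> (\<lambda>l. gcd l (int n)) ` A" for e
  proof -
    have e: "e = int (nat e)" and "e dvd int n" using that by auto
    then have "nat e dvd n" by (metis int_dvd_int_iff)
    with e show ?thesis using ramanujan_sum_integral[OF n] by metis
  qed
  then show ?thesis
    using gcd_class_sum_integral[of n A j] n A closed by (simp add: Ints_sum)
qed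

section \<open>Sets whose differences form an atom\<close>

lemma prime_not_square:
  fixes p s :: nat
  assumes "prime p"
  shows "s * s \<noteq> p"
  using assms prime_product[of s s] by auto

text \<open>This is 2-integrality in terms of exponents: the product of \<open>b a^s\<close> and
  \<open>b a^t\<close> is \<open>a^(t - s)\<close>, and the residues with gcd \<open>d\<close> are
  the exponents of the atom of \<open>a^d\<close>.\<close>

locale uniform_differences =
  fixes n d m :: nat and T :: "int set"
  assumes n_pos: "n > 0" and T_subset: "T \<subseteq> {0..<int n}"
    and d_dvd: "d dvd n" and d_neq: "d \<noteq> n" and m_pos: "1 \<le> m"
    and differences: "image_mset (\<lambda>(s, t). (t - s) mod int n) (mset_set (T \<times> T))
      = replicate_mset (card T) 0 + repeat_mset m (mset_set {r \<in> {0..<int n}. gcd r (int n) = int d})"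
begin

lemma d_pos: "d > 0"
  using d_dvd n_pos by (cases d) auto

lemma n_eq: "n = d * (n div d)"
  using d_dvd by simp

lemma quotient_gt_1: "n div d > 1"
proof (rule ccontr)
  assume "\<not> ?thesis"
  then have "n div d = 0 \<or> n div d = 1" by linarith
  then show False using n_eq d_neq n_pos by auto
qed

lemma finite_T: "finite T"
  using T_subset finite_subset by blast

text \<open>Cancelling \<open>d\<close> from the gcd turns sums over the atom into sums over the
  units modulo \<open>n div d\<close>.\<close>

lemma units_eq: "{r \<in> {0..<int n}. gcd r (int n) = int d}
  = (*) (int d) ` {x \<in> {0..<int (n div d)}. coprime x (int (n div d))}"
proof (intro equalityI subsetI)
  fix r assume r: "r \<in> {r \<in> {0..<int n}. gcd r (int n) = int d}"
  then obtain x where x: "r = int d * x" by (metis (mono_tags) dvdE gcd_dvd1 mem_Collect_eq)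
  have "gcd r (int n) = int d * gcd x (int (n div d))"
    unfolding x by (subst n_eq) (simp add: gcd_mult_distrib_int[symmetric])
  then have "coprime x (int (n div d))"
    using r d_pos by (simp add: coprime_iff_gcd_eq_1)
  moreover have "x \<in> {0..<int (n div d)}"
    using r d_pos unfolding x by (subst (asm) n_eq) (auto simp: zero_le_mult_iff)
  ultimately show "r \<in> (*) (int d) ` {x \<in> {0..<int (n div d)}. coprime x (int (n div d))}"
    using x by blast
next
  fix r assume "r \<in> (*) (int d) ` {x \<in> {0..<int (n div d)}. coprime x (int (n div d))}"
  then obtain x where x: "r = int d * x" "x \<in> {0..<int (n div d)}" "coprime x (int (n div d))" by blast
  have "gcd r (int n) = int d * gcd x (int (n div d))"
    unfolding x(1) by (subst n_eq) (simp add: gcd_mult_distrib_int[symmetric])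
  then have "gcd r (int n) = int d" using x(3) by simp
  moreover have "int d * x < int d * int (n div d)"
    using x(2) d_pos by (intro mult_strict_left_mono) auto
  then have "r < int n"
    using n_eq x(1) by (metis of_nat_mult)
  ultimately show "r \<in> {r \<in> {0..<int n}. gcd r (int n) = int d}"
    using x by auto
qed

lemma sum_units: "(\<Sum>r | r \<in> {0..<int n} \<and> gcd r (int n) = int d. f r)
  = (\<Sum>x | x \<in> {0..<int (n div d)} \<and> coprime x (int (n div d)). f (int d * x))"
  using d_pos by (subst units_eq, subst sum.reindex) (auto simp: inj_on_def)

lemma card_units: "card {r \<in> {0..<int n}. gcd r (int n) = int d} = totient (n div d)"
proof -
  \<comment> \<open>The known count runs over \<open>{0<..n}\<close> instead of
    \<open>{0..<n}\<close>. The ends 0 and \<open>n\<close> both have gcd \<open>n\<close> with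
    \<open>n\<close>, which differs from \<open>d\<close>.\<close>
  have "bij_betw int {k \<in> {0<..n}. gcd k n = d} {r \<in> {0..<int n}. gcd r (int n) = int d}"
  proof (rule bij_betw_byWitness[of _ nat])
    show "int ` {k \<in> {0<..n}. gcd k n = d} \<subseteq> {r \<in> {0..<int n}. gcd r (int n) = int d}"
    proof (rule image_subsetI)
      fix k assume k: "k \<in> {k \<in> {0<..n}. gcd k n = d}"
      then have "k \<noteq> n" using d_neq by auto
      then show "int k \<in> {r \<in> {0..<int n}. gcd r (int n) = int d}" using k by simp
    qed
    show "nat ` {r \<in> {0..<int n}. gcd r (int n) = int d} \<subseteq> {k \<in> {0<..n}. gcd k n = d}"
    proof (rule image_subsetI)
      fix r assume r: "r \<in> {r \<in> {0..<int n}. gcd r (int n) = int d}"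
      then have r': "r = int (nat r)" by simp
      have "gcd (nat r) n = d" using r r' by (metis (mono_tags, lifting) gcd_int_int_eq mem_Collect_eq of_nat_eq_iff)
      moreover have "r \<noteq> 0" using r d_neq by auto
      ultimately show "nat r \<in> {k \<in> {0<..n}. gcd k n = d}" using r by auto
    qed
  qed auto
  from bij_betw_same_card[OF this] show ?thesis
    unfolding card_gcd_eq_totient[OF n_pos d_dvd] by (rule sym)
qed

text \<open>Semiring values allow both uses: \<open>f = 1\<close> in the naturals counts pairs, and
  a complex character gives the norms of the Fourier coefficients.\<close>

lemma sum_differences:
  fixes f :: "int \<Rightarrow> 'a :: comm_semiring_1"
  shows "(\<Sum>(s, t) \<in> T \<times> T. f ((t - s) mod int n))
    = of_nat (card T) * f 0 + of_nat m * (\<Sum>r | r \<in> {0..<int n} \<and> gcd r (int n) = int d. f r)"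
proof -
  have rep: "\<Sum>\<^sub># (image_mset f (repeat_mset k M)) = of_nat k * \<Sum>\<^sub># (image_mset f M)" for k M
  proof (induction k)
    case (Suc k)
    have "\<Sum>\<^sub># (image_mset f (repeat_mset (Suc k) M)) = \<Sum>\<^sub># (image_mset f M) + \<Sum>\<^sub># (image_mset f (repeat_mset k M))"
      by simp
    then show ?case unfolding Suc.IH by (simp only: of_nat_Suc distrib_right mult_1)
  qed simp
  have "(\<Sum>(s, t) \<in> T \<times> T. f ((t - s) mod int n))
    = \<Sum>\<^sub># (image_mset f (image_mset (\<lambda>(s, t). (t - s) mod int n) (mset_set (T \<times> T))))"
    by (simp add: sum_unfold_sum_mset image_mset.compositionality comp_def case_prod_unfold)
  also have "\<dots> = of_nat (card T) * f 0 + of_nat m * (\<Sum>r | r \<in> {0..<int n} \<and> gcd r (int n) = int d. f r)"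
    unfolding differences by (simp add: rep sum_unfold_sum_mset)
  finally show ?thesis .
qed

lemma card_square: "card T * card T = card T + m * totient (n div d)"
  using sum_differences[of "\<lambda>_. 1 :: nat"] card_units by (simp add: card_cartesian_product)

text \<open>The residue of \<open>t - s\<close> belongs to the multiset of differences and is
  nonzero, because \<open>s\<close> and \<open>t\<close> are distinct representatives. So it comes
  from the atom.\<close>

lemma gcd_difference:
  assumes "s \<in> T" "t \<in> T" "s \<noteq> t"
  shows "gcd (t - s) (int n) = int d"
proof -
  have "(t - s) mod int n \<noteq> 0"
  proof
    assume "(t - s) mod int n = 0"
    then have "t mod int n = s mod int n" by (simp add: mod_eq_dvd_iff mod_eq_0_iff_dvd)
    then show False using assms T_subset by (auto simp: subset_eq)
  qed
  moreover have "(t - s) mod int n \<in> (\<lambda>(s, t). (t - s) mod int n) ` (T \<times> T)"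
    using assms by (intro image_eqI[of _ _ "(s, t)"]) auto
  then have "(t - s) mod int n \<in># image_mset (\<lambda>(s, t). (t - s) mod int n) (mset_set (T \<times> T))"
    using finite_T by simp
  ultimately have "gcd ((t - s) mod int n) (int n) = int d"
    unfolding differences
    by (auto split: if_splits simp: count_mset_set' count_greater_zero_iff[symmetric] simp del: count_greater_zero_iff)
  then show ?thesis using n_pos by simp
qed

lemma dvd_difference:
  assumes "s \<in> T" "t \<in> T"
  shows "int d dvd t - s"
  using gcd_difference[OF assms] by (metis diff_self dvd_0_right gcd_dvd1)

text \<open>All of \<open>T\<close> lies in one class modulo \<open>d\<close>. Two elements whose
  quotients by \<open>d\<close> agree modulo \<open>p\<close> would differ by a multiple of
  \<open>d * p\<close>, a divisor of \<open>n\<close>, although their difference has gcd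
  \<open>d\<close> with \<open>n\<close>. So \<open>T\<close> embeds in the residues modulo
  \<open>p\<close>.\<close>

lemma card_le_prime:
  assumes p: "prime p" "p dvd n div d"
  shows "card T \<le> p"
proof (cases "T = {}")
  case False
  then obtain t\<^sub>0 where t\<^sub>0: "t\<^sub>0 \<in> T" by blast
  have p0: "p > 1" using p(1) prime_gt_1_nat by blast
  let ?f = "\<lambda>s. ((s - t\<^sub>0) div int d) mod int p"
  have "inj_on ?f T"
  proof (rule inj_onI, rule ccontr)
    fix s t assume st: "s \<in> T" "t \<in> T" "?f s = ?f t" "s \<noteq> t"
    obtain x y where xy: "s - t\<^sub>0 = int d * x" "t - t\<^sub>0 = int d * y"
      using dvd_difference t\<^sub>0 st by (metis dvdE)
    then have "x mod int p = y mod int p" using st(3) d_pos by simp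
    then have "int p dvd y - x" by (metis mod_eq_dvd_iff)
    moreover have "t - s = int d * (y - x)" using xy by (simp add: algebra_simps)
    ultimately have "int d * int p dvd t - s" by simp
    moreover have "int d * int p dvd int n"
      using p(2) n_eq by (metis mult_dvd_mono dvd_refl of_nat_dvd_iff of_nat_mult)
    ultimately have "int d * int p dvd int d"
      using gcd_difference[OF st(1,2,4)] by (metis gcd_greatest)
    then have "int (d * p) \<le> int d" using d_pos by (intro zdvd_imp_le) auto
    then show False using p0 d_pos by simp
  qed
  moreover have "?f ` T \<subseteq> {0..<int p}" using p0 by auto
  ultimately have "card T \<le> card {0..<int p}" by (intro card_inj_on_le) auto
  then show ?thesis by simp
qed simp

text \<open>The squared norm is a sum over ordered pairs that depends on their differences only, so
  \<open>sum_differences\<close> evaluates it.\<close>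

lemma fourier_norm_square:
  "of_real ((norm (\<Sum>t\<in>T. root_char n (j * t)))\<^sup>2)
    = of_nat (card T) + of_nat m * (\<Sum>r | r \<in> {0..<int n} \<and> gcd r (int n) = int d. root_char n (j * r))"
proof -
  have "of_real ((norm (\<Sum>t\<in>T. root_char n (j * t)))\<^sup>2)
    = (\<Sum>s\<in>T. root_char n (- (j * s))) * (\<Sum>t\<in>T. root_char n (j * t))"
    unfolding complex_norm_square by (simp add: cnj_root_char mult.commute)
  also have "\<dots> = (\<Sum>(s, t) \<in> T \<times> T. root_char n (j * ((t - s) mod int n)))"
    unfolding sum_product sum.cartesian_product
  proof (intro sum.cong refl, clarify)
    fix s t
    have "root_char n (- (j * s)) * root_char n (j * t) = root_char n (j * (t - s))"
      by (simp add: root_char_add[symmetric] algebra_simps)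
    also have "\<dots> = root_char n (j * ((t - s) mod int n))"
      using n_pos by (intro root_char_cong) (simp_all add: mod_mult_right_eq)
    finally show "root_char n (- (j * s)) * root_char n (j * t) = root_char n (j * ((t - s) mod int n))" .
  qed
  also have "\<dots> = of_nat (card T) + of_nat m * (\<Sum>r | r \<in> {0..<int n} \<and> gcd r (int n) = int d. root_char n (j * r))"
    by (subst sum_differences[of "\<lambda>r. root_char n (j * r)"]) simp
  finally show ?thesis .
qed

text \<open>Let \<open>h\<close> be \<open>n div d\<close> divided by \<open>p\<close>. It has the
  same prime factors as \<open>n div d\<close>, so translation by \<open>h\<close> permutes the
  units, while it multiplies the sum by a root of unity different from 1.\<close>

lemma sum_units_eq_0:
  assumes p: "prime p" and "p * p dvd n div d"
  shows "(\<Sum>r | r \<in> {0..<int n} \<and> gcd r (int n) = int d. root_char n r) = 0"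
proof -
  let ?M = "int (n div d)"
  let ?V = "{x \<in> {0..<?M}. coprime x ?M}"
  let ?f = "\<lambda>x. root_char n (int d * x)"
  obtain k where k: "n div d = p * p * k" using assms(2) by blast
  define h where "h = int (p * k)"
  have M: "?M = int p * h" using k by (simp add: h_def)
  have p1: "p > 1" using p prime_gt_1_nat by blast
  have "k \<noteq> 0" using k quotient_gt_1 by (cases k) auto
  then have h0: "h > 0" using p1 by (simp add: h_def)
  have unit: "coprime x ?M \<longleftrightarrow> coprime x h" for x
    unfolding M by (auto simp: h_def)
  have cop: "coprime ((x + l * h) mod ?M) ?M \<longleftrightarrow> coprime x ?M" for x l
  proof -
    have "coprime ((x + l * h) mod ?M) ?M \<longleftrightarrow> coprime (x + l * h) ?M"
      using quotient_gt_1 by (simp add: coprime_iff_gcd_eq_1 gcd.commute[of _ ?M] del: of_nat_div)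
    also have "\<dots> \<longleftrightarrow> coprime (x + l * h) h" by (rule unit)
    also have "\<dots> \<longleftrightarrow> coprime x h" 
      by (metis coprime_iff_gcd_eq_1 gcd.commute gcd_add_mult mult.commute add.commute)
    finally show ?thesis using unit by simp
  qed
  have mem: "(x + l * h) mod ?M \<in> ?V" if "x \<in> ?V" for x l
    using that cop quotient_gt_1 by simp
  have f_mod: "?f (x mod ?M) = ?f x" for x
  proof (rule root_char_cong[OF n_pos])
    have "int d * (x mod ?M) = (int d * x) mod int n"
      by (metis mult_mod_right n_eq of_nat_mult)
    then show "int d * (x mod ?M) mod int n = int d * x mod int n" by simp
  qed
  have "(\<Sum>x\<in>?V. ?f x) = (\<Sum>x\<in>?V. ?f (x + 1 * h))"
  proof (rule sum.reindex_bij_witness[of _ "\<lambda>x. (x + 1 * h) mod ?M" "\<lambda>x. (x + (- 1) * h) mod ?M"])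
    fix x assume x: "x \<in> ?V"
    show "(x + (- 1) * h) mod ?M \<in> ?V" "(x + 1 * h) mod ?M \<in> ?V"
      by (rule mem[OF x])+
    show "((x + (- 1) * h) mod ?M + 1 * h) mod ?M = x" "((x + 1 * h) mod ?M + (- 1) * h) mod ?M = x"
      using x by (simp_all add: mod_simps del: of_nat_div)
    show "?f ((x + (- 1) * h) mod ?M + 1 * h) = ?f x"
      using f_mod by (metis \<open>((x + (- 1) * h) mod ?M + 1 * h) mod ?M = x\<close>)
  qed
  also have "\<dots> = (\<Sum>x\<in>?V. ?f x) * ?f h"
    by (simp add: ring_distribs root_char_add sum_distrib_right)
  finally have "(\<Sum>x\<in>?V. ?f x) * (1 - ?f h) = 0" by (simp add: algebra_simps)
  moreover have "?f h \<noteq> 1"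
  proof
    assume "?f h = 1"
    then have "int n dvd int d * h" using n_pos by (simp add: root_char_eq_1_iff)
    then have "int d * int p * h dvd int d * h"
      using n_eq M by (metis mult.assoc of_nat_mult)
    then have "int d * int p * h \<le> int d * h" using d_pos h0 by (intro zdvd_imp_le) auto
    then show False using p1 d_pos h0 by simp
  qed
  ultimately have "(\<Sum>x\<in>?V. ?f x) = 0" by simp
  then show ?thesis by (subst sum_units) simp
qed

text \<open>The sum over all residues modulo \<open>p\<close> vanishes, and 0 is the only residue
  that is not a unit.\<close>

lemma sum_units_prime:
  assumes p: "prime p" and M: "n div d = p"
  shows "(\<Sum>r | r \<in> {0..<int n} \<and> gcd r (int n) = int d. root_char n r) = - 1"
proof -
  have p1: "p > 1" using p prime_gt_1_nat by blast
  have V: "{x. x \<in> {0..<int p} \<and> coprime x (int p)} = {0..<int p} - {0}"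
  proof (intro equalityI subsetI)
    fix x assume "x \<in> {0..<int p} - {0}"
    then have "\<not> int p dvd x" using zdvd_not_zless by force
    then have "coprime (int p) x" using p by (intro prime_imp_coprime) auto
    then show "x \<in> {x. x \<in> {0..<int p} \<and> coprime x (int p)}"
      using \<open>x \<in> _\<close> by (simp add: coprime_commute)
  qed (use p1 in auto)
  have "(\<Sum>x = 0..<int p. root_char n (1 * (int d * x))) = 0"
    using p1 n_eq M by (subst sum_root_char_multiples[OF n_pos, of d p]) auto
  then have "(\<Sum>x\<in>{0..<int p} - {0}. root_char n (int d * x)) = - 1"
    using p1 by (simp add: sum_diff1)
  then show ?thesis by (subst sum_units) (simp only: M V)
qed

text \<open>With t = \<open>card T\<close> and M = \<open>n div d\<close>, counting gives (p - 1)(q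
  - 1) <= m phi(M) = t(t - 1) <= p(p - 1). Oddness gives q >= p + 2, so the left side is at least (p
  - 1)(p + 1), which is too large.\<close>

lemma no_two_primes:
  assumes odd: "odd n" and p: "prime p" "p dvd n div d" and q: "prime q" "q dvd n div d" and "p < q"
  shows False
proof -
  have "n div d dvd n" using n_eq by (metis dvd_triv_right)
  then have "odd p" "odd q" using odd p q by (meson dvd_trans)+
  then have q2: "q \<ge> p + 2" using \<open>p < q\<close> by presburger
  have p1: "p > 1" using p(1) prime_gt_1_nat by blast
  have cop: "coprime p q" using p q \<open>p < q\<close> by (intro primes_coprime) auto
  then have "p * q dvd n div d" using p q by (intro divides_mult)
  then have "totient (p * q) \<le> totient (n div d)"
    using quotient_gt_1 by (intro totient_dvd_mono) auto
  also have "totient (n div d) \<le> m * totient (n div d)"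
    using m_pos by simp
  finally have "(p - 1) * (q - 1) \<le> m * totient (n div d)"
    using cop p(1) q(1) by (simp add: totient_mult_coprime totient_prime)
  moreover have "(p - 1) * (p + 1) \<le> (p - 1) * (q - 1)"
    using q2 by (intro mult_le_mono2) auto
  moreover have "card T * card T = card T + m * totient (n div d)" by (rule card_square)
  moreover have "card T * card T - card T \<le> p * p - p"
  proof -
    have "card T * (card T - 1) \<le> p * (p - 1)"
      using card_le_prime[OF p] by (intro mult_le_mono) auto
    then show ?thesis by (simp add: diff_mult_distrib2)
  qed
  ultimately have "(p - 1) * (p + 1) \<le> p * p - p" by linarith
  then show False using p1 by (cases p) auto
qed

lemma prime_quotient:
  assumes odd: "odd n" and s: "norm (\<Sum>t\<in>T. root_char n t) = of_nat s"
  shows "prime (n div d)"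
proof -
  obtain p where p: "prime p" "p dvd n div d"
    using prime_factor_nat quotient_gt_1 by (metis less_irrefl)
  have p1: "p > 1" using p(1) prime_gt_1_nat by blast
  obtain k where k: "n div d = p * k" using p(2) by blast
  show ?thesis
  proof (cases "p dvd k")
    case True
    then have pp: "p * p dvd n div d" using k by simp
    then have "totient (p * p) \<le> totient (n div d)"
      using quotient_gt_1 by (intro totient_dvd_mono) auto
    moreover have "totient (p * p) = p * (p - 1)"
      using p(1) totient_prime_power[of p 2] by (simp add: power2_eq_square)
    moreover have "totient (n div d) \<le> m * totient (n div d)" using m_pos by simp
    ultimately have "card T + p * (p - 1) \<le> card T * card T"
      using card_square by linarith
    \<comment> \<open>If t = \<open>card T\<close> were below \<open>p\<close>, then t^2 <= p(p -
      1). This leaves only t = 0, which fails because p(p - 1) is positive.\<close>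
    then have "p \<le> card T"
    proof (rule_tac ccontr)
      assume *: "card T + p * (p - 1) \<le> card T * card T" and "\<not> p \<le> card T"
      then have "card T * card T \<le> (p - 1) * card T" by (intro mult_le_mono1) linarith
      also have "\<dots> \<le> p * (p - 1)" using \<open>\<not> p \<le> card T\<close> by (simp add: mult.commute mult_le_mono)
      finally have "card T = 0" using * by linarith
      then show False using * p1 by simp
    qed
    then have "card T = p" using card_le_prime[OF p] by simp
    \<comment> \<open>The sum over the atom vanishes here, so the square of the integer
      \<open>s\<close> equals the prime \<open>p\<close>.\<close>
    then have "complex_of_real ((of_nat s)\<^sup>2) = of_real (of_nat p)"
      using fourier_norm_square[of 1] sum_units_eq_0[OF p(1) pp] s by simp
    then have "s * s = p"
      by (simp only: of_real_eq_iff power2_eq_square of_nat_mult[symmetric] of_nat_eq_iff)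
    then show ?thesis using prime_not_square[OF p(1)] by blast
  next
    case False
    have "k = 1"
    proof (rule ccontr)
      assume "k \<noteq> 1"
      then obtain q where q: "prime q" "q dvd k" using prime_factor_nat by blast
      have "q dvd n div d" using q(2) k by simp
      moreover have "q \<noteq> p" using q(2) False by blast
      ultimately show False using no_two_primes[OF odd] p q(1) by (metis nat_neq_iff)
    qed
    then show ?thesis using p(1) k by simp
  qed
qed

lemma card_cases:
  assumes odd: "odd n" and s: "norm (\<Sum>t\<in>T. root_char n t) = of_nat s"
  shows "card T = n div d \<or> card T = n div d - 1"
proof -
  define p where "p = n div d"
  have p: "prime p" using prime_quotient[OF assms] by (simp add: p_def)
  have p1: "p > 1" using p prime_gt_1_nat by blast
  define t where "t = card T"
  have t_le: "t \<le> p" using card_le_prime[OF p] by (simp add: p_def t_def)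
  have sq: "t * t = t + m * (p - 1)"
    using card_square p by (simp add: p_def t_def totient_prime)
  \<comment> \<open>For a prime quotient the sum over the atom is -1, so s^2 = t - m.\<close>
  have "complex_of_real ((of_nat s)\<^sup>2) = of_nat t - of_nat m"
    using fourier_norm_square[of 1] sum_units_prime[OF p p_def[symmetric]] s by (simp add: t_def)
  then have "complex_of_nat (s * s + m) = of_nat t" by (simp add: power2_eq_square)
  then have sm: "s * s + m = t" by (simp only: of_nat_eq_iff)
  have "s \<le> s * s" by (cases s) auto
  then have st: "s < t" using sm m_pos by linarith
  \<comment> \<open>Substitute t = s^2 + m into the first term of t + m(p - 1).\<close>
  have "t * t = s * s + m * p"
    using sq sm p1 by (cases p) auto
  then have eq: "(int t - int s) * (int t + int s) = int m * int p"
    by (simp add: algebra_simps flip: of_nat_mult of_nat_add)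
  then have "int p dvd (int t - int s) * (int t + int s)" by simp
  moreover have "prime (int p)" using p by simp
  ultimately consider "int p dvd int t - int s" | "int p dvd int t + int s"
    using prime_dvd_mult_iff by blast
  then have "t = p \<or> t = p - 1"
  proof cases
    case 1
    then have "int p \<le> int t - int s" using st by (intro zdvd_imp_le) auto
    then show ?thesis using t_le by linarith
  next
    \<comment> \<open>Since 0 < t + s < 2p, here t + s = p and therefore t - s = m. Comparison with
      s^2 = t - m gives s^2 = s; the solutions 0 and 1 yield t = p and t = p - 1.\<close>
    case 2
    then obtain c where c: "int t + int s = int p * c" by blast
    have "0 < int t + int s" "int t + int s < int p * 2" using st t_le by linarith+
    then have "0 < int p * c" "int p * c < int p * 2" using c by simp_all
    then have "c = 1" using p1 by (auto simp: zero_less_mult_iff)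
    then have tsp: "int t + int s = int p" using c by simp
    then have "int t - int s = int m" using eq p1 by simp
    then have "s * s = s" using sm st by linarith
    then have "s = 0 \<or> s = 1" by (cases s) auto
    then show ?thesis using tsp by linarith
  qed
  then show ?thesis by (simp add: t_def p_def)
qed

end

section \<open>Residue classes, complete or without one point\<close>

lemma bij_betw_residue_class:
  assumes "d > 0"
  shows "bij_betw (\<lambda>x. c mod int d + int d * x) {0..<int p} {r \<in> {0..<int (d * p)}. int d dvd r - c}"
proof (rule bij_betw_byWitness[of _ "\<lambda>r. r div int d"])
  have d: "0 \<le> c mod int d" "c mod int d < int d" using assms by auto
  show "\<forall>x\<in>{0..<int p}. (c mod int d + int d * x) div int d = x" using d by simp
  show "\<forall>r\<in>{r \<in> {0..<int (d * p)}. int d dvd r - c}. c mod int d + int d * (r div int d) = r"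
    by (auto simp: mod_eq_dvd_iff[symmetric]) (metis mod_mult_div_eq)
  show "(\<lambda>x. c mod int d + int d * x) ` {0..<int p} \<subseteq> {r \<in> {0..<int (d * p)}. int d dvd r - c}"
  proof (rule image_subsetI)
    fix x assume x: "x \<in> {0..<int p}"
    have "int d * (x + 1) \<le> int d * int p" using x assms by (intro mult_left_mono) auto
    then have "c mod int d + int d * x < int (d * p)" using d by (simp add: ring_distribs)
    moreover have "int d dvd c mod int d + int d * x - c"
      by (metis dvd_add_left_iff dvd_triv_left mod_mod_trivial mod_eq_dvd_iff add_diff_eq diff_add_eq)
    ultimately show "c mod int d + int d * x \<in> {r \<in> {0..<int (d * p)}. int d dvd r - c}"
      using d x assms by simp
  qed
  show "(\<lambda>r. r div int d) ` {r \<in> {0..<int (d * p)}. int d dvd r - c} \<subseteq> {0..<int p}"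
  proof (rule image_subsetI)
    fix r assume r: "r \<in> {r \<in> {0..<int (d * p)}. int d dvd r - c}"
    have "int d * (r div int d) + r mod int d = r" "0 \<le> r mod int d"
      using assms by simp_all
    moreover have "r < int d * int p" using r by simp
    ultimately have "int d * (r div int d) < int d * int p" by linarith
    then show "r div int d \<in> {0..<int p}"
      using r assms by (simp add: pos_imp_zdiv_nonneg_iff)
  qed
qed

text \<open>\<open>T\<close> is contained in a class modulo \<open>d\<close>, which has
  \<open>n div d\<close> elements, and by \<open>card_cases\<close> it misses at most one of
  them.\<close>

lemma (in uniform_differences) residue_class:
  assumes odd: "odd n" and s: "norm (\<Sum>t\<in>T. root_char n t) = of_nat s"
  obtains c r where "T = {r \<in> {0..<int n}. int d dvd r - c} \<or>
    T = {r \<in> {0..<int n}. int d dvd r - c} - {r} \<and> r \<in> {r \<in> {0..<int n}. int d dvd r - c}"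
proof -
  \<comment> \<open>An empty \<open>T\<close> would make \<open>m * totient (n div d)\<close> vanish
    in \<open>card_square\<close>.\<close>
  have "card T > 0"
    using card_square m_pos quotient_gt_1 by (intro Nat.gr0I) auto
  then obtain c where c: "c \<in> T" by (metis card_gt_0_iff ex_in_conv)
  let ?C = "{r \<in> {0..<int n}. int d dvd r - c}"
  have sub: "T \<subseteq> ?C" using T_subset dvd_difference[OF c] by auto
  have fin: "finite ?C" by (rule finite_subset[of _ "{0..<int n}"]) auto
  have cardC: "card ?C = n div d"
    using bij_betw_same_card[OF bij_betw_residue_class[OF d_pos, of c "n div d"]] d_dvd by simp
  from card_cases[OF assms] show ?thesis
  proof
    assume "card T = n div d"
    then have "T = ?C" using sub fin cardC by (intro card_subset_eq) auto
    then show ?thesis using that by blast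
  next
    assume "card T = n div d - 1"
    then have "card (?C - T) = 1"
      using card_Diff_subset[OF finite_T sub] cardC quotient_gt_1 by simp
    then obtain r where "?C - T = {r}" by (metis card_1_singletonE)
    then have "T = ?C - {r}" "r \<in> ?C" using sub by auto
    then show ?thesis using that by blast
  qed
qed

text \<open>The transform of a complete class is 0 or \<open>p\<close> times a root of unity, and
  removing a point subtracts a root of unity. If \<open>p\<close> divides \<open>j\<close>, the
  character is constant on the class and the norm becomes p - 1; otherwise it becomes 1.\<close>

lemma residue_class_fourier_norm:
  assumes n: "n > 0" "n = d * p"
    and T: "T = {r \<in> {0..<int n}. int d dvd r - c} \<or>
      T = {r \<in> {0..<int n}. int d dvd r - c} - {r} \<and> r \<in> {r \<in> {0..<int n}. int d dvd r - c}"
  shows "norm (\<Sum>t\<in>T. root_char n (j * t)) \<in> \<int>"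
proof -
  have d0: "d > 0" using n by (cases d) auto
  let ?C = "{r \<in> {0..<int n}. int d dvd r - c}"
  let ?c = "c mod int d"
  let ?z = "root_char n (j * ?c)"
  have fin: "finite ?C" by (rule finite_subset[of _ "{0..<int n}"]) auto
  have "(\<Sum>t\<in>?C. root_char n (j * t)) = (\<Sum>x = 0..<int p. root_char n (j * (?c + int d * x)))"
    using sum.reindex_bij_betw[OF bij_betw_residue_class[OF d0, of c p], of "\<lambda>t. root_char n (j * t)"] n(2)
    by (simp only:)
  also have "\<dots> = ?z * (\<Sum>x = 0..<int p. root_char n (j * (int d * x)))"
    by (simp add: ring_distribs root_char_add sum_distrib_left)
  also have "\<dots> = (if int p dvd j then of_nat p * ?z else 0)"
    by (simp add: sum_root_char_multiples[OF n])
  finally have C: "(\<Sum>t\<in>?C. root_char n (j * t)) = (if int p dvd j then of_nat p * ?z else 0)" .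
  show ?thesis
  proof (cases "T = ?C")
    case True
    then show ?thesis unfolding True C by (simp add: norm_mult)
  next
    case False
    then have r: "T = ?C - {r}" "r \<in> ?C" using T by auto
    have sum: "(\<Sum>t\<in>T. root_char n (j * t)) = (\<Sum>t\<in>?C. root_char n (j * t)) - root_char n (j * r)"
      unfolding r(1) using fin r(2) by (simp add: sum_diff1)
    show ?thesis
    proof (cases "int p dvd j")
      case True
      have "int d dvd r - ?c"
        using r(2) by (metis (no_types, lifting) mem_Collect_eq mod_eq_dvd_iff mod_mod_trivial)
      then have "int n dvd j * r - j * ?c"
        using True n(2) by (metis mult_dvd_mono mult.commute of_nat_mult right_diff_distrib)
      then have "root_char n (j * r) = ?z"
        using n(1) by (intro root_char_cong) (simp_all add: mod_eq_dvd_iff)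
      then have "(\<Sum>t\<in>T. root_char n (j * t)) = of_int (int p - 1) * ?z"
        unfolding sum C using True by (simp add: ring_distribs)
      then show ?thesis by (simp only: norm_mult norm_of_int norm_root_char) simp
    next
      case False
      then show ?thesis unfolding sum C by simp
    qed
  qed
qed

section \<open>Eigenfunctions\<close>

text \<open>Reindexing by \<open>l\<close> costs one character value. This is what decouples the
  eigenvalue equations into separate frequencies \<open>j\<close>.\<close>

lemma sum_periodic_shift_character:
  assumes "n > 0" and F: "\<And>i. F (i mod int n) = F i"
  shows "(\<Sum>i = 0..<int n. F (i + l) * root_char n (- j * i))
    = root_char n (j * l) * (\<Sum>i = 0..<int n. F i * root_char n (- j * i))"
proof -
  let ?f = "\<lambda>i. F i * root_char n (- j * i)"
  have "?f (i mod int n) = ?f i" for i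
    unfolding F using root_char_cong[OF assms(1), of "- j * (i mod int n)" "- j * i"]
    by (simp add: mod_mult_right_eq del: mult_minus_left)
  then have "(\<Sum>i = 0..<int n. ?f (i + l)) = (\<Sum>i = 0..<int n. ?f i)"
    by (rule sum_periodic_shift[where f = ?f, OF assms(1)])
  then have "root_char n (j * l) * (\<Sum>i = 0..<int n. ?f i) = (\<Sum>i = 0..<int n. root_char n (j * l) * ?f (i + l))"
    by (simp only: sum_distrib_left[symmetric])
  also have "\<dots> = (\<Sum>i = 0..<int n. F (i + l) * root_char n (- j * i))"
  proof (intro sum.cong refl)
    fix i
    have "root_char n (j * l) * root_char n (- j * (i + l)) = root_char n (- j * i)"
      unfolding root_char_add[symmetric] by (simp add: algebra_simps)
    then show "root_char n (j * l) * ?f (i + l) = F (i + l) * root_char n (- j * i)"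
      by (metis mult.left_commute)
  qed
  finally show ?thesis by (rule sym)
qed

lemma sum_root_char_symmetric:
  assumes n: "n > 0" and A: "A \<subseteq> {0..<int n}" and sym: "\<And>l. l \<in> A \<Longrightarrow> (- l) mod int n \<in> A"
  shows "(\<Sum>l\<in>A. root_char n (- j * l)) = (\<Sum>l\<in>A. root_char n (j * l))"
proof (rule sum.reindex_bij_witness[of _ "\<lambda>l. (- l) mod int n" "\<lambda>l. (- l) mod int n"])
  fix l assume l: "l \<in> A"
  then show "(- ((- l) mod int n)) mod int n = l" using A by (auto simp: mod_simps subset_eq)
  then show "(- ((- l) mod int n)) mod int n = l" .
  show "(- l) mod int n \<in> A" "(- l) mod int n \<in> A" using sym l by auto
  have "j * ((- l) mod int n) mod int n = (- j * l) mod int n"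
    by (metis mod_mult_right_eq mult_minus_left mult_minus_right)
  then show "root_char n (j * ((- l) mod int n)) = root_char n (- j * l)"
    by (rule root_char_cong[OF n])
qed

text \<open>\<open>F i\<close> and \<open>G i\<close> are the values of an eigenfunction at
  \<open>a^i\<close> and at \<open>a^i b\<close>. The signs come from
  \<open>a^i (b a^t) = a^(i - t) b\<close>, \<open>(a^i b) a^l = a^(i - l) b\<close> and
  \<open>(a^i b)(b a^t) = a^(i + t)\<close>.\<close>

definition dihedral_eigenfunction ::
    "nat \<Rightarrow> int set \<Rightarrow> int set \<Rightarrow> complex \<Rightarrow> (int \<Rightarrow> complex) \<Rightarrow> (int \<Rightarrow> complex) \<Rightarrow> bool" where
  "dihedral_eigenfunction n A T k F G \<longleftrightarrow>
    (\<forall>i. F (i mod int n) = F i) \<and> (\<forall>i. G (i mod int n) = G i) \<and> (\<exists>i. F i \<noteq> 0 \<or> G i \<noteq> 0) \<and>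
    (\<forall>i. (\<Sum>l\<in>A. F (i + l)) + (\<Sum>t\<in>T. G (i - t)) = k * F i) \<and>
    (\<forall>i. (\<Sum>l\<in>A. G (i - l)) + (\<Sum>t\<in>T. F (i + t)) = k * G i)"

lemma cnj_sum_root_char:
  "cnj (\<Sum>t\<in>T. root_char n (j * t)) = (\<Sum>t\<in>T. root_char n (- j * t))"
  by (simp add: cnj_root_char)

text \<open>At frequency \<open>j\<close> the operator is the matrix with rows (c, cnj \<tau>) and
  (\<tau>, c). The vector (\<sigma> |\<tau>|, \<tau>) solves its eigenvalue equation for c +
  \<sigma> |\<tau>|.\<close>

lemma dihedral_eigenfunction_character:
  assumes n: "n > 0" and A: "A \<subseteq> {0..<int n}" and sym: "\<And>l. l \<in> A \<Longrightarrow> (- l) mod int n \<in> A"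
    and \<sigma>: "\<sigma> = 1 \<or> \<sigma> = - 1"
  shows "\<exists>F G. dihedral_eigenfunction n A T
    ((\<Sum>l\<in>A. root_char n (j * l)) + \<sigma> * of_real (norm (\<Sum>t\<in>T. root_char n (j * t)))) F G"
proof -
  define c where "c = (\<Sum>l\<in>A. root_char n (j * l))"
  define \<tau> where "\<tau> = (\<Sum>t\<in>T. root_char n (j * t))"
  have c': "(\<Sum>l\<in>A. root_char n (- j * l)) = c"
    unfolding c_def by (rule sum_root_char_symmetric[OF n A sym])
  have \<tau>': "(\<Sum>t\<in>T. root_char n (- j * t)) = cnj \<tau>"
    unfolding \<tau>_def by (rule cnj_sum_root_char[symmetric])
  \<comment> \<open>For \<tau> = 0 the general vector would be zero; (1, 0) replaces it.\<close>
  define \<alpha> \<beta> where "\<alpha> = (if \<tau> = 0 then 1 else \<sigma> * of_real (norm \<tau>))" and "\<beta> = \<tau>"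
  define k where "k = c + \<sigma> * of_real (norm \<tau>)"
  have \<sigma>2: "\<sigma> * (\<sigma> * x) = x" for x using \<sigma> by auto
  have nn: "of_real (norm \<tau>) * of_real (norm \<tau>) = cnj \<tau> * \<tau>"
    using complex_norm_square[of \<tau>] by (simp add: power2_eq_square mult.commute)
  have eq1: "c * \<alpha> + cnj \<tau> * \<beta> = k * \<alpha>"
    using nn \<sigma>2 by (auto simp: \<alpha>_def \<beta>_def k_def ring_distribs mult_ac)
  have eq2: "c * \<beta> + \<tau> * \<alpha> = k * \<beta>"
    by (simp add: \<alpha>_def \<beta>_def k_def ring_distribs mult_ac)
  let ?e = "\<lambda>i. root_char n (j * i)"
  have mod: "?e (i mod int n) = ?e i" for i
    using n by (intro root_char_cong) (simp_all add: mod_mult_right_eq)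
  have add: "?e (i + l) = ?e i * ?e l" for i l
    by (simp add: ring_distribs root_char_add)
  have diff: "?e (i - l) = ?e i * root_char n (- j * l)" for i l
    unfolding root_char_add[symmetric] by (simp add: algebra_simps)
  have "dihedral_eigenfunction n A T k (\<lambda>i. \<alpha> * ?e i) (\<lambda>i. \<beta> * ?e i)"
    unfolding dihedral_eigenfunction_def
  proof (intro conjI allI)
    have "\<alpha> * ?e 0 \<noteq> 0" using \<sigma> by (auto simp: \<alpha>_def)
    then show "\<exists>i. \<alpha> * ?e i \<noteq> 0 \<or> \<beta> * ?e i \<noteq> 0" by blast
  next
    fix i
    have "(\<Sum>l\<in>A. \<alpha> * ?e (i + l)) + (\<Sum>t\<in>T. \<beta> * ?e (i - t))
      = (c * \<alpha> + (\<Sum>t\<in>T. root_char n (- j * t)) * \<beta>) * ?e i"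
      unfolding add diff c_def by (simp add: sum_distrib_left sum_distrib_right ring_distribs mult_ac)
    then show "(\<Sum>l\<in>A. \<alpha> * ?e (i + l)) + (\<Sum>t\<in>T. \<beta> * ?e (i - t)) = k * (\<alpha> * ?e i)"
      unfolding \<tau>' eq1 by (simp only: mult.assoc)
    have "(\<Sum>l\<in>A. \<beta> * ?e (i - l)) + (\<Sum>t\<in>T. \<alpha> * ?e (i + t))
      = ((\<Sum>l\<in>A. root_char n (- j * l)) * \<beta> + \<tau> * \<alpha>) * ?e i"
      unfolding add diff \<tau>_def by (simp add: sum_distrib_left sum_distrib_right ring_distribs mult_ac)
    then show "(\<Sum>l\<in>A. \<beta> * ?e (i - l)) + (\<Sum>t\<in>T. \<alpha> * ?e (i + t)) = k * (\<beta> * ?e i)"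
      unfolding c' eq2 by (simp only: mult.assoc)
  qed (simp_all add: mod)
  then show ?thesis unfolding k_def c_def \<tau>_def by blast
qed

text \<open>At every frequency the Fourier coefficients of \<open>F\<close> and \<open>G\<close>
  satisfy the 2 by 2 system for \<open>k\<close>. If \<open>k\<close> is none of the listed values,
  they all vanish, and by Fourier inversion so do \<open>F\<close> and \<open>G\<close>.\<close>

lemma dihedral_eigenfunction_eigenvalue:
  assumes n: "n > 0" and A: "A \<subseteq> {0..<int n}" and sym: "\<And>l. l \<in> A \<Longrightarrow> (- l) mod int n \<in> A"
    and FG: "dihedral_eigenfunction n A T k F G"
  shows "\<exists>j. k = (\<Sum>l\<in>A. root_char n (j * l)) + of_real (norm (\<Sum>t\<in>T. root_char n (j * t))) \<or>
    k = (\<Sum>l\<in>A. root_char n (j * l)) - of_real (norm (\<Sum>t\<in>T. root_char n (j * t)))"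
proof (rule ccontr)
  assume contra: "\<not> ?thesis"
  have F_mod: "\<And>i. F (i mod int n) = F i" and G_mod: "\<And>i. G (i mod int n) = G i"
    and nz: "\<exists>i. F i \<noteq> 0 \<or> G i \<noteq> 0"
    and eq1: "\<And>i. (\<Sum>l\<in>A. F (i + l)) + (\<Sum>t\<in>T. G (i - t)) = k * F i"
    and eq2: "\<And>i. (\<Sum>l\<in>A. G (i - l)) + (\<Sum>t\<in>T. F (i + t)) = k * G i"
    using FG unfolding dihedral_eigenfunction_def by blast+
  define \<alpha> where "\<alpha> j = (\<Sum>i = 0..<int n. F i * root_char n (- j * i))" for j
  define \<beta> where "\<beta> j = (\<Sum>i = 0..<int n. G i * root_char n (- j * i))" for j
  have zero: "\<alpha> j = 0 \<and> \<beta> j = 0" for j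
  proof -
    define c where "c = (\<Sum>l\<in>A. root_char n (j * l))"
    define \<tau> where "\<tau> = (\<Sum>t\<in>T. root_char n (j * t))"
    have c': "(\<Sum>l\<in>A. root_char n (j * - l)) = c"
      using sum_root_char_symmetric[OF n A sym, of j] by (simp add: c_def)
    have \<tau>': "(\<Sum>t\<in>T. root_char n (j * - t)) = cnj \<tau>"
      using cnj_sum_root_char[of n j T] by (simp add: \<tau>_def)
    \<comment> \<open>The map \<open>f\<close> is the identity or negation, for the forward and
      backward translations in the two equations.\<close>
    have shift: "(\<Sum>i = 0..<int n. (\<Sum>x\<in>X. H (i + f x)) * root_char n (- j * i))
      = (\<Sum>x\<in>X. root_char n (j * f x)) * (\<Sum>i = 0..<int n. H i * root_char n (- j * i))"
      if "\<And>i. H (i mod int n) = H i" for H :: "int \<Rightarrow> complex" and f and X :: "int set"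
    proof -
      have "(\<Sum>i = 0..<int n. (\<Sum>x\<in>X. H (i + f x)) * root_char n (- j * i))
        = (\<Sum>x\<in>X. \<Sum>i = 0..<int n. H (i + f x) * root_char n (- j * i))"
        unfolding sum_distrib_right by (rule sum.swap)
      then show ?thesis
        unfolding sum_distrib_right[of _ X] sum_periodic_shift_character[where F = H, OF n that] by (simp only:)
    qed
    have "k * \<alpha> j = (\<Sum>i = 0..<int n. ((\<Sum>l\<in>A. F (i + l)) + (\<Sum>t\<in>T. G (i + - t))) * root_char n (- j * i))"
      using eq1 by (simp add: \<alpha>_def sum_distrib_left mult.assoc)
    also have "\<dots> = c * \<alpha> j + cnj \<tau> * \<beta> j"
      unfolding distrib_right sum.distrib shift[where H = F and X = A and f = "\<lambda>l. l", OF F_mod] shift[where H = G and X = T and f = uminus, OF G_mod] \<tau>'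
      by (simp add: c_def \<alpha>_def \<beta>_def)
    finally have e1: "(k - c) * \<alpha> j = cnj \<tau> * \<beta> j" by (simp add: algebra_simps)
    have "k * \<beta> j = (\<Sum>i = 0..<int n. ((\<Sum>l\<in>A. G (i + - l)) + (\<Sum>t\<in>T. F (i + t))) * root_char n (- j * i))"
      using eq2 by (simp add: \<beta>_def sum_distrib_left mult.assoc)
    also have "\<dots> = c * \<beta> j + \<tau> * \<alpha> j"
      unfolding distrib_right sum.distrib shift[where H = F and X = T and f = "\<lambda>l. l", OF F_mod] shift[where H = G and X = A and f = uminus, OF G_mod] c'
      by (simp add: \<tau>_def \<alpha>_def \<beta>_def)
    finally have e2: "(k - c) * \<beta> j = \<tau> * \<alpha> j" by (simp add: algebra_simps)
    have nn: "cnj \<tau> * \<tau> = of_real (norm \<tau>) * of_real (norm \<tau>)"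
      using complex_norm_square[of \<tau>] by (simp add: power2_eq_square mult.commute)
    \<comment> \<open>Using the system twice separates the unknowns: both are annihilated by (k -
      c)^2 - |\<tau>|^2, whose two linear factors are nonzero by \<open>contra\<close>.\<close>
    have "(k - c) * ((k - c) * \<alpha> j) = (cnj \<tau> * \<tau>) * \<alpha> j"
      unfolding e1 using e2 by (simp add: mult_ac)
    moreover have "(k - c) * ((k - c) * \<beta> j) = (cnj \<tau> * \<tau>) * \<beta> j"
      unfolding e2 using e1 by (simp add: mult_ac)
    moreover have "x = 0" if "(k - c) * ((k - c) * x) = (cnj \<tau> * \<tau>) * x" for x
    proof -
      have "(k - (c + of_real (norm \<tau>))) * ((k - (c - of_real (norm \<tau>))) * x) = 0"
        using that unfolding nn by (simp add: algebra_simps)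
      then show ?thesis using contra unfolding c_def \<tau>_def by auto
    qed
    ultimately show ?thesis by blast
  qed
  have "F i = 0 \<and> G i = 0" for i
  proof -
    have i: "i mod int n \<in> {0..<int n}" using n by simp
    have "of_nat n * F (i mod int n) = 0" "of_nat n * G (i mod int n) = 0"
      using zero fourier_inversion[OF n i, of F] fourier_inversion[OF n i, of G]
      by (simp_all add: \<alpha>_def \<beta>_def)
    then show ?thesis using n by (simp add: F_mod G_mod)
  qed
  then show False using nz by blast
qed

section \<open>Spectra of Cayley graphs\<close>

text \<open>Vectors indexed along \<open>vs\<close> correspond to functions on the group, which
  removes the enumeration from the right-hand side.\<close>

lemma (in group) eigenvalue_cayley_graph_iff:
  assumes S: "S \<subseteq> carrier G" and vs: "distinct vs" "set vs = carrier G"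
  shows "eigenvalue (adjacency_matrix (cayley_graph G S) vs) k \<longleftrightarrow>
    (\<exists>v. (\<exists>x \<in> carrier G. v x \<noteq> 0) \<and> (\<forall>x \<in> carrier G. (\<Sum>s\<in>S. v (x \<otimes> s)) = k * v x))"
proof -
  let ?A = "adjacency_matrix (cayley_graph G S) vs"
  let ?N = "length vs"
  let ?w = "\<lambda>v. vec ?N (\<lambda>i. v (vs ! i))"
  have nth: "i < ?N \<Longrightarrow> vs ! i \<in> carrier G" for i using vs(2) nth_mem by blast
  have bij: "bij_betw ((!) vs) {..<?N} (carrier G)"
    using bij_betw_nth[OF vs(1), of "{..<?N}" "carrier G"] vs(2) by simp
  have mult: "(?A *\<^sub>v ?w v) $ i = (\<Sum>s\<in>S. v (vs ! i \<otimes> s))" if i: "i < ?N" for v i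
  proof -
    let ?x = "vs ! i"
    have x: "?x \<in> carrier G" using nth i .
    have "(?A *\<^sub>v ?w v) $ i = (\<Sum>j<?N. if inv ?x \<otimes> vs ! j \<in> S then v (vs ! j) else 0)"
      using i nth by (auto simp: adjacency_matrix_def cayley_graph_def scalar_prod_def atLeast0LessThan intro!: sum.cong)
    also have "\<dots> = (\<Sum>y\<in>carrier G. if inv ?x \<otimes> y \<in> S then v y else 0)"
      by (rule sum.reindex_bij_betw[OF bij])
    also have "\<dots> = (\<Sum>y | y \<in> carrier G \<and> inv ?x \<otimes> y \<in> S. v y)"
      using vs(2) by (intro sum.inter_filter[symmetric]) (metis finite_set)
    \<comment> \<open>The neighbours of \<open>?x\<close> are its right multiples by the elements of
      \<open>S\<close>, each obtained once.\<close>
    also have "\<dots> = (\<Sum>s\<in>S. v (?x \<otimes> s))"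
      by (rule sum.reindex_bij_witness[of _ "\<lambda>s. ?x \<otimes> s" "\<lambda>y. inv ?x \<otimes> y"])
        (use S x in \<open>auto simp: m_assoc[symmetric] subset_eq\<close>)
    finally show ?thesis .
  qed
  have iff: "eigenvector ?A (?w v) k \<longleftrightarrow>
    (\<exists>x \<in> carrier G. v x \<noteq> 0) \<and> (\<forall>x \<in> carrier G. (\<Sum>s\<in>S. v (x \<otimes> s)) = k * v x)" for v
  proof -
    have "?w v \<noteq> 0\<^sub>v ?N \<longleftrightarrow> (\<exists>i<?N. v (vs ! i) \<noteq> 0)"
      by (auto simp: vec_eq_iff)
    also have "\<dots> \<longleftrightarrow> (\<exists>x \<in> carrier G. v x \<noteq> 0)"
      unfolding vs(2)[symmetric] by (metis in_set_conv_nth)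
    finally have 1: "?w v \<noteq> 0\<^sub>v ?N \<longleftrightarrow> (\<exists>x \<in> carrier G. v x \<noteq> 0)" .
    have "?A *\<^sub>v ?w v = k \<cdot>\<^sub>v ?w v \<longleftrightarrow> (\<forall>i<?N. (\<Sum>s\<in>S. v (vs ! i \<otimes> s)) = k * v (vs ! i))"
      using mult[of _ v] by (auto simp: vec_eq_iff adjacency_matrix_def simp del: index_mult_mat_vec)
    also have "\<dots> \<longleftrightarrow> (\<forall>x \<in> carrier G. (\<Sum>s\<in>S. v (x \<otimes> s)) = k * v x)"
      unfolding vs(2)[symmetric] all_set_conv_all_nth ..
    finally show ?thesis using 1 unfolding eigenvector_def by (simp add: adjacency_matrix_def)
  qed
  have vec: "\<exists>v. w = ?w v" if "w \<in> carrier_vec ?N" for w :: "complex vec"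
  proof
    let ?v = "\<lambda>x. w $ the_inv_into {..<?N} ((!) vs) x"
    have "the_inv_into {..<?N} ((!) vs) (vs ! i) = i" if "i < ?N" for i
      using bij that by (intro the_inv_into_f_f) (auto simp: bij_betw_def)
    then show "w = ?w ?v" using that by (auto simp: vec_eq_iff)
  qed
  have "dim_row ?A = ?N" by (simp add: adjacency_matrix_def)
  then have "w \<in> carrier_vec ?N" if "eigenvector ?A w k" for w
    using that by (simp add: eigenvector_def)
  then have "eigenvalue ?A k \<longleftrightarrow> (\<exists>v. eigenvector ?A (?w v) k)"
    unfolding eigenvalue_def using vec by metis
  then show ?thesis unfolding iff .
qed

text \<open>All enumerations have the same eigenvalues by the preceding criterion, and finiteness
  supplies one, so the quantifier over \<open>vs\<close> is not vacuous.\<close>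

lemma (in group) integral_cayley_graph_iff:
  assumes S: "S \<subseteq> carrier G" and fin: "finite (carrier G)"
  shows "integral_graph (cayley_graph G S) \<longleftrightarrow>
    (\<forall>k :: complex. (\<exists>v. (\<exists>x \<in> carrier G. v x \<noteq> 0) \<and> (\<forall>x \<in> carrier G. (\<Sum>s\<in>S. v (x \<otimes> s)) = k * v x)) \<longrightarrow> k \<in> \<int>)"
proof -
  define Q where "Q k \<longleftrightarrow> (\<exists>v. (\<exists>x \<in> carrier G. v x \<noteq> 0) \<and>
    (\<forall>x \<in> carrier G. (\<Sum>s\<in>S. v (x \<otimes> s)) = k * v x))" for k :: complex
  have V: "pverts (cayley_graph G S) = carrier G" by (simp add: cayley_graph_def)
  have iff: "eigenvalue (adjacency_matrix (cayley_graph G S) vs) k \<longleftrightarrow> Q k"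
    if "distinct vs" "set vs = carrier G" for vs k
    unfolding Q_def by (rule eigenvalue_cayley_graph_iff[OF S that])
  obtain vs where "distinct vs" "set vs = carrier G"
    using finite_distinct_list[OF fin] by blast
  then have "integral_graph (cayley_graph G S) \<longleftrightarrow> (\<forall>k. Q k \<longrightarrow> k \<in> \<int>)"
    unfolding integral_graph_def V using fin iff by metis
  then show ?thesis unfolding Q_def .
qed

section \<open>The dihedral group\<close>

context group
begin

text \<open>Within \<open>generate G {a}\<close>, subgroups are unions of classes for the relation
  of generating the same subgroup. This passes to unions and intersections and, by symmetry of the
  relation, to complements.\<close>

lemma generator_in_subgroup_algebra_closed:
  assumes "A \<in> subgroup_algebra G a" and a: "a \<in> carrier G"
    and "x \<in> A" "y \<in> generate G {a}" "generate G {x} = generate G {y}"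
  shows "y \<in> A"
  using assms(1,3-5)
proof (induction arbitrary: x y rule: subgroup_algebra.induct)
  case (subgroup K)
  then have "generate G {x} \<subseteq> K" by (intro generate_subgroup_incl) auto
  moreover have "y \<in> generate G {y}" by (auto intro: generate.incl)
  ultimately show ?case using subgroup by blast
next
  case (complement A)
  show ?case
  proof (rule ccontr)
    assume "y \<notin> generate G {a} - A"
    then have "y \<in> A" using complement.prems by blast
    then have "x \<in> A" using complement by blast
    then show False using complement.prems by blast
  qed
qed blast+

text \<open>The extra set \<open>A\<close> keeps the intersection over an empty \<open>I\<close>
  inside the algebra.\<close>

lemma subgroup_algebra_Inter:
  assumes "finite I" and "A \<in> subgroup_algebra G a" and "\<And>i. i \<in> I \<Longrightarrow> B i \<in> subgroup_algebra G a"
  shows "A \<inter> (\<Inter>i\<in>I. B i) \<in> subgroup_algebra G a"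
  using assms
proof (induction I rule: finite_induct)
  case (insert i I)
  then have "A \<inter> (\<Inter>i\<in>I. B i) \<in> subgroup_algebra G a" "B i \<in> subgroup_algebra G a"
    by simp_all
  then have "(A \<inter> (\<Inter>i\<in>I. B i)) \<inter> B i \<in> subgroup_algebra G a"
    by (rule subgroup_algebra.inter)
  moreover have "A \<inter> (\<Inter>i\<in>insert i I. B i) = (A \<inter> (\<Inter>i\<in>I. B i)) \<inter> B i" by auto
  ultimately show ?case by (simp only:)
qed simp

lemma subgroup_algebra_Union:
  assumes "finite I" and "\<And>i. i \<in> I \<Longrightarrow> B i \<in> subgroup_algebra G a" and a: "a \<in> carrier G"
  shows "(\<Union>i\<in>I. B i) \<in> subgroup_algebra G a"
  using assms(1,2)
proof (induction I rule: finite_induct)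
  case empty
  \<comment> \<open>The inductive definition has no clause for the empty set; it arises as the
    complement of the whole subgroup.\<close>
  have "generate G {a} \<in> subgroup_algebra G a"
    using a by (intro subgroup_algebra.subgroup generate_is_subgroup) auto
  then have "generate G {a} - generate G {a} \<in> subgroup_algebra G a"
    by (rule subgroup_algebra.complement)
  then show ?case by simp
next
  case (insert i I)
  then have "B i \<union> (\<Union>i\<in>I. B i) \<in> subgroup_algebra G a"
    by (intro subgroup_algebra.union) auto
  then show ?case by simp
qed

lemma generate_singleton_subgroup_algebra:
  assumes a: "a \<in> carrier G" and x: "x \<in> generate G {a}"
  shows "generate G {x} \<in> subgroup_algebra G a"
proof -
  have "subgroup (generate G {a}) G" using a by (intro generate_is_subgroup) auto
  moreover have "x \<in> carrier G" using x a generate_incl[of "{a}"] by auto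
  ultimately have "subgroup (generate G {x}) G" "generate G {x} \<subseteq> generate G {a}"
    using x generate_is_subgroup[of "{x}"] generate_subgroup_incl[of "{x}" "generate G {a}"] by simp_all
  then show ?thesis by (intro subgroup_algebra.subgroup)
qed

text \<open>The atom \<open>[g]\<close> is what remains of \<open>\<langle>g\<rangle>\<close> when all subgroups \<open>\<langle>x\<rangle> \<noteq> \<langle>g\<rangle>\<close> with \<open>x \<in> \<langle>g\<rangle>\<close>
  are removed.\<close>

lemma atom_in_subgroup_algebra:
  assumes a: "a \<in> carrier G" and fin: "finite (generate G {a})" and g: "g \<in> generate G {a}"
  shows "atom G a g \<in> subgroup_algebra G a"
proof -
  have gc: "g \<in> carrier G" using g a generate_incl[of "{a}"] by auto
  have sub: "generate G {g} \<subseteq> generate G {a}"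
    using a g by (intro generate_subgroup_incl generate_is_subgroup) auto
  let ?I = "{x \<in> generate G {g}. generate G {x} \<noteq> generate G {g}}"
  have self: "y \<in> generate G {y}" for y by (auto intro: generate.incl)
  have incl: "generate G {y} \<subseteq> generate G {x}" if "y \<in> generate G {x}" "x \<in> carrier G" for x y
    using that by (intro generate_subgroup_incl generate_is_subgroup) auto
  have eq: "atom G a g = generate G {g} \<inter> (\<Inter>x\<in>?I. generate G {a} - generate G {x})"
  proof (intro equalityI subsetI)
    fix y assume "y \<in> atom G a g"
    then have y: "y \<in> generate G {a}" "generate G {y} = generate G {g}" by (auto simp: atom_def)
    have "y \<notin> generate G {x}" if "x \<in> ?I" for x
    proof
      assume *: "y \<in> generate G {x}"
      have "x \<in> carrier G" using that gc generate_incl[of "{g}"] by auto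
      then have "generate G {g} \<subseteq> generate G {x}" using incl[OF *] y by simp
      moreover have "generate G {x} \<subseteq> generate G {g}" using that incl gc by blast
      ultimately show False using that by blast
    qed
    then show "y \<in> generate G {g} \<inter> (\<Inter>x\<in>?I. generate G {a} - generate G {x})"
      using y self[of y] by auto
  next
    fix y assume "y \<in> generate G {g} \<inter> (\<Inter>x\<in>?I. generate G {a} - generate G {x})"
    then have y: "y \<in> generate G {g}" "\<And>x. x \<in> ?I \<Longrightarrow> y \<notin> generate G {x}" by blast+
    then have "y \<notin> ?I" using self by blast
    then show "y \<in> atom G a g" using y(1) sub by (auto simp: atom_def)
  qed
  have I: "finite ?I" using fin sub by (auto intro: finite_subset)
  have compl: "generate G {a} - generate G {x} \<in> subgroup_algebra G a" if "x \<in> ?I" for x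
    using that sub a by (intro subgroup_algebra.complement generate_singleton_subgroup_algebra) auto
  show ?thesis
    unfolding eq by (rule subgroup_algebra_Inter[OF I generate_singleton_subgroup_algebra[OF a g] compl])
qed

text \<open>A set with the closure property is the union of the atoms of its elements, and each atom
  lies in the algebra.\<close>

lemma subgroup_algebra_iff:
  assumes a: "a \<in> carrier G" and fin: "finite (generate G {a})" and A: "A \<subseteq> generate G {a}"
  shows "A \<in> subgroup_algebra G a \<longleftrightarrow>
    (\<forall>x\<in>A. \<forall>y\<in>generate G {a}. generate G {x} = generate G {y} \<longrightarrow> y \<in> A)"
proof
  assume "A \<in> subgroup_algebra G a"
  then show "\<forall>x\<in>A. \<forall>y\<in>generate G {a}. generate G {x} = generate G {y} \<longrightarrow> y \<in> A"
    using generator_in_subgroup_algebra_closed[OF _ a] by blast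
next
  assume *: "\<forall>x\<in>A. \<forall>y\<in>generate G {a}. generate G {x} = generate G {y} \<longrightarrow> y \<in> A"
  have "A = (\<Union>g\<in>A. atom G a g)"
    using A * by (fastforce simp: atom_def)
  moreover have "(\<Union>g\<in>A. atom G a g) \<in> subgroup_algebra G a"
    using A a fin by (intro subgroup_algebra_Union atom_in_subgroup_algebra) (auto intro: finite_subset)
  ultimately show "A \<in> subgroup_algebra G a" by simp
qed

end

section \<open>The dihedral group in terms of exponents\<close>

context dihedral_group
begin

context
  assumes n_pos: "n > 0"
begin

lemmas swap = dihedral_relations_swap[OF a_closed b_closed b_pow_2 b_a_b]

lemma b_mult_b: "b \<otimes> b = \<one>"
  using b_pow_2 b_closed by (simp add: numeral_2_eq_2)

lemma a_pow_mod: "a [^] (i mod int n) = a [^] (i :: int)"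
  by (rule int_pow_mod[OF a_closed a_pow_n])

lemma normal_form_eq_iff:
  "a [^] (i::int) \<otimes> (if e then b else \<one>) = a [^] (j::int) \<otimes> (if f then b else \<one>)
    \<longleftrightarrow> i mod int n = j mod int n \<and> e = f"
proof -
  have "a [^] i \<otimes> (if e then b else \<one>) = a [^] j \<otimes> (if f then b else \<one>) \<longleftrightarrow>
    a [^] (i mod int n) \<otimes> (if e then b else \<one>) = a [^] (j mod int n) \<otimes> (if f then b else \<one>)"
    by (simp only: a_pow_mod)
  also have "\<dots> \<longleftrightarrow> (i mod int n, e) = (j mod int n, f)"
    using bij_betw_imp_inj_on[OF bij_betw_normal_form[OF n_pos]] n_pos
    by (subst inj_on_eq_iff[symmetric, where f = "\<lambda>(i, e). a [^] (i::int) \<otimes> (if e then b else \<one>)"]) auto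
  finally show ?thesis by simp
qed

lemma a_pow_eq_iff: "a [^] (i::int) = a [^] (j::int) \<longleftrightarrow> i mod int n = j mod int n"
  using normal_form_eq_iff[of i False j False] a_closed by simp

lemma b_a_pow_eq_iff: "b \<otimes> a [^] (i::int) = b \<otimes> a [^] (j::int) \<longleftrightarrow> i mod int n = j mod int n"
  using a_closed b_closed by (simp add: a_pow_eq_iff)

lemma a_pow_neq: "a [^] (i::int) \<noteq> b \<otimes> a [^] (j::int)"
  using normal_form_eq_iff[of i False "- j" True] a_closed b_closed by (simp add: swap)

lemma carrier_cases:
  assumes "x \<in> carrier D"
  obtains i :: int where "x = a [^] i" | i :: int where "x = a [^] i \<otimes> b"
proof -
  have "x \<in> (\<lambda>(i, e). a [^] (i::int) \<otimes> (if e then b else \<one>)) ` ({0..<int n} \<times> UNIV)"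
    using assms bij_betw_normal_form[OF n_pos] by (simp add: bij_betw_def)
  then obtain i e where "x = a [^] (i::int) \<otimes> (if e then b else \<one>)" by auto
  then show ?thesis using that a_closed by (cases e) auto
qed

text \<open>Uniqueness of the normal form allows the values on rotations and on reflections to be
  prescribed independently.\<close>

lemma carrier_function:
  fixes F F' :: "int \<Rightarrow> 'c"
  assumes F: "\<And>i. F (i mod int n) = F i" and F': "\<And>i. F' (i mod int n) = F' i"
  shows "\<exists>v. (\<forall>i. v (a [^] (i::int)) = F i) \<and> (\<forall>i. v (a [^] (i::int) \<otimes> b) = F' i)"
proof -
  let ?f = "\<lambda>(i, e). a [^] (i::int) \<otimes> (if e then b else \<one>)"
  let ?A = "{0..<int n} \<times> (UNIV :: bool set)"
  define v where "v x = (case the_inv_into ?A ?f x of (i, e) \<Rightarrow> if e then F' i else F i)" for x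
  have v: "v (a [^] i \<otimes> (if e then b else \<one>)) = (if e then F' i else F i)" for i e
  proof -
    have "a [^] i \<otimes> (if e then b else \<one>) = ?f (i mod int n, e)" by (simp add: a_pow_mod)
    moreover have "the_inv_into ?A ?f (?f (i mod int n, e)) = (i mod int n, e)"
      using bij_betw_imp_inj_on[OF bij_betw_normal_form[OF n_pos]] n_pos
      by (intro the_inv_into_f_f) auto
    ultimately show ?thesis by (simp add: v_def F F')
  qed
  show ?thesis using v[of _ False] v[of _ True] a_closed by (intro exI[of _ v]) simp
qed

lemma generate_a: "generate D {a} = (\<lambda>i. a [^] (i::int)) ` {0..<int n}"
proof -
  have "generate D {a} = (\<lambda>i. a [^] (i::int)) ` UNIV"
    using generate_pow[OF a_closed] by auto
  also have "\<dots> = (\<lambda>i. a [^] (i::int)) ` {0..<int n}"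
  proof (intro equalityI subsetI)
    fix x assume "x \<in> range (\<lambda>i. a [^] (i::int))"
    then obtain i :: int where "x = a [^] (i mod int n)" using a_pow_mod by auto
    then show "x \<in> (\<lambda>i. a [^] (i::int)) ` {0..<int n}" using n_pos by auto
  qed auto
  finally show ?thesis .
qed

text \<open>Membership is solvability of a linear congruence modulo \<open>n\<close>, decided by
  Bezout's identity.\<close>

lemma a_pow_in_generate_iff:
  "a [^] (k::int) \<in> generate D {a [^] (i::int)} \<longleftrightarrow> gcd i (int n) dvd k"
proof -
  have "generate D {a [^] i} = {a [^] (i * m) | m. m \<in> UNIV}"
    using generate_pow[of "a [^] i"] a_closed by (simp add: int_pow_pow)
  then have "a [^] k \<in> generate D {a [^] i} \<longleftrightarrow> (\<exists>m. k mod int n = i * m mod int n)"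
    by (auto simp: a_pow_eq_iff)
  also have "\<dots> \<longleftrightarrow> gcd i (int n) dvd k"
  proof
    assume "\<exists>m. k mod int n = i * m mod int n"
    then obtain m where "int n dvd k - i * m" by (auto simp: mod_eq_dvd_iff)
    then have "gcd i (int n) dvd k - i * m" by (meson dvd_trans gcd_dvd2)
    moreover have "gcd i (int n) dvd i * m" by simp
    ultimately show "gcd i (int n) dvd k" by (metis dvd_add diff_add_cancel)
  next
    assume "gcd i (int n) dvd k"
    then obtain c where c: "k = gcd i (int n) * c" by blast
    obtain u w where "u * i + w * int n = gcd i (int n)" using bezout_int by blast
    then have "k = i * (u * c) + int n * (w * c)" unfolding c by (metis (no_types) distrib_right mult.assoc mult.commute)
    then have "k mod int n = i * (u * c) mod int n" by simp
    then show "\<exists>m. k mod int n = i * m mod int n" by blast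
  qed
  finally show ?thesis .
qed

lemma generate_a_pow_eq_iff:
  "generate D {a [^] (i::int)} = generate D {a [^] (j::int)} \<longleftrightarrow> gcd i (int n) = gcd j (int n)"
proof
  assume eq: "generate D {a [^] i} = generate D {a [^] j}"
  have self: "x \<in> generate D {x}" for x by (auto intro: generate.incl)
  have "gcd i (int n) dvd j" "gcd j (int n) dvd i"
    using eq self by (metis a_pow_in_generate_iff)+
  then show "gcd i (int n) = gcd j (int n)"
    by (intro zdvd_antisym_nonneg) auto
next
  assume eq: "gcd i (int n) = gcd j (int n)"
  have sub: "generate D {a [^] i} \<subseteq> generate D {a [^] j}" if eq: "gcd i (int n) = gcd j (int n)" for i j :: int
  proof (rule generate_subgroup_incl)
    show "{a [^] i} \<subseteq> generate D {a [^] j}"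
      using a_pow_in_generate_iff[of i j] eq[symmetric] by simp
  qed (use a_closed in \<open>auto intro: generate_is_subgroup\<close>)
  show "generate D {a [^] i} = generate D {a [^] j}"
    using sub[OF eq] sub[OF eq[symmetric]] by blast
qed

lemma subgroup_algebra_iff_gcd_closed:
  assumes S1: "S1 \<subseteq> generate D {a}"
  shows "S1 \<in> subgroup_algebra D a \<longleftrightarrow>
    (\<forall>l \<in> {i \<in> {0..<int n}. a [^] i \<in> S1}. \<forall>l' \<in> {0..<int n}.
      gcd l (int n) = gcd l' (int n) \<longrightarrow> l' \<in> {i \<in> {0..<int n}. a [^] i \<in> S1})"
proof -
  have ball: "(\<forall>x\<in>S1. P x) \<longleftrightarrow> (\<forall>l \<in> {i \<in> {0..<int n}. a [^] i \<in> S1}. P (a [^] l))" for P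
    using S1 unfolding generate_a by blast
  have fin: "finite (generate D {a})" unfolding generate_a by simp
  show ?thesis
    unfolding subgroup_algebra_iff[OF a_closed fin S1] ball generate_a by (auto simp: generate_a_pow_eq_iff)
qed

lemma b_coset_a: "b <# generate D {a} = (\<lambda>i. b \<otimes> a [^] (i::int)) ` {0..<int n}"
  unfolding generate_a l_coset_def by auto

text \<open>This translates the cosets in the final statement into residue classes modulo
  \<open>d\<close>.\<close>

lemma b_a_pow_coset:
  assumes d: "d dvd n"
  shows "(b \<otimes> a [^] (j::nat)) <# generate D {a [^] (d::nat)}
    = (\<lambda>i. b \<otimes> a [^] (i::int)) ` {r \<in> {0..<int n}. int d dvd r - int j}"
proof -
  have gcd: "gcd (int d) (int n) = int d" using d by simp
  have mem: "a [^] r \<in> generate D {a [^] d} \<longleftrightarrow> int d dvd r" for r :: int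
    using a_pow_in_generate_iff[of r "int d"] unfolding gcd by (simp add: int_pow_int)
  have sub: "generate D {a [^] d} \<subseteq> (\<lambda>i. a [^] (i::int)) ` {0..<int n}"
    unfolding generate_a[symmetric]
  proof (rule generate_subgroup_incl)
    show "{a [^] d} \<subseteq> generate D {a}"
      using generate_pow[OF a_closed] int_pow_int[of D a d] by (auto) metis
  qed (use a_closed in \<open>auto intro: generate_is_subgroup\<close>)
  have mult: "b \<otimes> a [^] j \<otimes> a [^] r = b \<otimes> a [^] (int j + r)" for r :: int
    using a_closed b_closed by (simp add: m_assoc int_pow_mult int_pow_int)
  show ?thesis
  proof (intro equalityI subsetI)
    fix x assume "x \<in> (b \<otimes> a [^] j) <# generate D {a [^] d}"
    then obtain y where y: "y \<in> generate D {a [^] d}" "x = b \<otimes> a [^] j \<otimes> y"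
      by (auto simp: l_coset_def)
    then obtain r :: int where r: "y = a [^] r" using sub by blast
    then have dr: "int d dvd r" using y mem by simp
    let ?i = "(int j + r) mod int n"
    have "x = b \<otimes> a [^] ?i" using y r mult by (simp add: a_pow_mod)
    moreover have "int d dvd ?i - int j"
    proof -
      have "?i mod int d = (int j + r) mod int d" using d by (simp add: mod_mod_cancel)
      also have "\<dots> = int j mod int d" using dr by (auto elim!: dvdE)
      finally show ?thesis by (simp add: mod_eq_dvd_iff)
    qed
    ultimately show "x \<in> (\<lambda>i. b \<otimes> a [^] (i::int)) ` {r \<in> {0..<int n}. int d dvd r - int j}"
      using n_pos by auto
  next
    fix x assume "x \<in> (\<lambda>i. b \<otimes> a [^] (i::int)) ` {r \<in> {0..<int n}. int d dvd r - int j}"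
    then obtain r where r: "x = b \<otimes> a [^] r" "int d dvd r - int j" by auto
    then have "x = b \<otimes> a [^] j \<otimes> a [^] (r - int j)" by (simp add: mult)
    then show "x \<in> (b \<otimes> a [^] j) <# generate D {a [^] d}"
      using r mem by (auto simp: l_coset_def)
  qed
qed

lemma atom_a_pow:
  assumes d: "d dvd n"
  shows "atom D a (a [^] (d::nat)) = (\<lambda>i. a [^] (i::int)) ` {r \<in> {0..<int n}. gcd r (int n) = int d}"
proof -
  have "gcd (int d) (int n) = int d" using d by simp
  then show ?thesis
    using generate_a_pow_eq_iff[of _ "int d"]
    unfolding atom_def generate_a by (auto simp: int_pow_int)
qed

lemma two_integral_uniform_differences:
  assumes S2: "S2 \<subseteq> b <# generate D {a}" and "two_integral D n a S2"
  shows "\<exists>d m. uniform_differences n d m {i \<in> {0..<int n}. b \<otimes> a [^] i \<in> S2}"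
proof -
  obtain d m where d: "d dvd n" "d \<noteq> n" and m: "1 \<le> m" and
    sq: "square_mset D S2 = replicate_mset (card S2) \<one>
      + repeat_mset m (mset_set (atom D a (a [^] d)))"
    using assms(2) unfolding two_integral_def by blast
  let ?T = "{i \<in> {0..<int n}. b \<otimes> a [^] i \<in> S2}"
  let ?g = "\<lambda>i. b \<otimes> a [^] (i::int)"
  let ?f = "\<lambda>i. a [^] (i::int)"
  let ?U = "{r \<in> {0..<int n}. gcd r (int n) = int d}"
  \<comment> \<open>The discrete logarithm to base \<open>a\<close>. Applied to the multiset
    identity for \<open>S2\<close>, it turns products of reflections into differences of
    exponents.\<close>
  let ?h = "the_inv_into {0..<int n} ?f"
  have inj_f: "inj_on ?f {0..<int n}" by (rule inj_onI) (simp add: a_pow_eq_iff)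
  have inj_g: "inj_on ?g ?T" by (rule inj_onI) (simp add: b_a_pow_eq_iff)
  have h: "?h (?f i) = i" if "i \<in> {0..<int n}" for i
    using the_inv_into_f_f[OF inj_f that] .
  have S2_eq: "S2 = ?g ` ?T" using S2 unfolding b_coset_a by auto
  have card: "card S2 = card ?T" by (subst S2_eq) (rule card_image[OF inj_g])
  have finT: "finite ?T" by (rule finite_subset[of _ "{0..<int n}"]) auto
  have mult: "?g s \<otimes> ?g t = ?f ((t - s) mod int n)" for s t
  proof -
    have "?g s \<otimes> ?g t = (a [^] (- s) \<otimes> b) \<otimes> (b \<otimes> a [^] t)" by (simp only: swap)
    also have "\<dots> = a [^] (- s) \<otimes> (b \<otimes> b) \<otimes> a [^] t"
      using a_closed b_closed by (simp add: m_assoc)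
    also have "\<dots> = ?f (t - s)"
      using a_closed int_pow_mult[of a "- s" t] by (simp add: b_mult_b)
    finally show ?thesis by (simp only: a_pow_mod)
  qed
  have "mset_set (S2 \<times> S2) = image_mset (map_prod ?g ?g) (mset_set (?T \<times> ?T))"
  proof -
    have "map_prod ?g ?g ` (?T \<times> ?T) = (?g ` ?T) \<times> (?g ` ?T)" by force
    then show ?thesis
      unfolding S2_eq[symmetric] image_mset_mset_set[OF map_prod_inj_on[OF inj_g inj_g]] by simp
  qed
  then have "square_mset D S2 = image_mset (\<lambda>(s, t). ?f ((t - s) mod int n)) (mset_set (?T \<times> ?T))"
    unfolding square_mset_def
    by (simp add: image_mset.compositionality comp_def case_prod_unfold mult)
  then have "image_mset ?h (square_mset D S2)
    = image_mset (\<lambda>(s, t). ?h (?f ((t - s) mod int n))) (mset_set (?T \<times> ?T))"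
    by (simp add: image_mset.compositionality comp_def case_prod_unfold)
  also have "\<dots> = image_mset (\<lambda>(s, t). (t - s) mod int n) (mset_set (?T \<times> ?T))"
    using n_pos h by (intro image_mset_cong) auto
  finally have 1: "image_mset ?h (square_mset D S2)
    = image_mset (\<lambda>(s, t). (t - s) mod int n) (mset_set (?T \<times> ?T))" .
  have atom: "mset_set (atom D a (a [^] d)) = image_mset ?f (mset_set ?U)"
    unfolding atom_a_pow[OF d(1)]
    by (rule image_mset_mset_set[symmetric], rule inj_on_subset[OF inj_f]) auto
  have rep: "image_mset ?h (repeat_mset m M) = repeat_mset m (image_mset ?h M)" for M
    by (induction m) simp_all
  have "image_mset ?h (image_mset ?f (mset_set ?U)) = mset_set ?U"
  proof -
    have finU: "finite ?U" by (rule finite_subset[of _ "{0..<int n}"]) auto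
    have "image_mset (\<lambda>i. ?h (?f i)) (mset_set ?U) = image_mset (\<lambda>i. i) (mset_set ?U)"
      using finU h by (intro image_mset_cong) auto
    then show ?thesis by (simp add: image_mset.compositionality comp_def)
  qed
  moreover have "?h \<one> = 0" using h[of 0] n_pos by simp
  ultimately have "image_mset ?h (square_mset D S2) = replicate_mset (card ?T) 0 + repeat_mset m (mset_set ?U)"
    unfolding sq atom by (simp add: rep card)
  then have "uniform_differences n d m ?T"
    using 1 n_pos d m by unfold_locales auto
  then show ?thesis by blast
qed

lemma cayley_sum:
  assumes S: "S = S1 \<union> S2" and S1: "S1 \<subseteq> generate D {a}" and S2: "S2 \<subseteq> b <# generate D {a}"
    and "x \<in> carrier D"
  shows "(\<Sum>s\<in>S. v (x \<otimes> s)) = (\<Sum>l | l \<in> {0..<int n} \<and> a [^] l \<in> S1. v (x \<otimes> a [^] l))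
    + (\<Sum>t | t \<in> {0..<int n} \<and> b \<otimes> a [^] t \<in> S2. v (x \<otimes> (b \<otimes> a [^] t)) :: complex)"
proof -
  let ?A = "{i. i \<in> {0..<int n} \<and> a [^] i \<in> S1}"
  let ?T = "{i. i \<in> {0..<int n} \<and> b \<otimes> a [^] i \<in> S2}"
  have inj: "inj_on (\<lambda>i. a [^] (i::int)) ?A" "inj_on (\<lambda>i. b \<otimes> a [^] (i::int)) ?T"
    by (auto intro!: inj_onI simp: a_pow_eq_iff b_a_pow_eq_iff)
  have eq: "S1 = (\<lambda>i. a [^] (i::int)) ` ?A" "S2 = (\<lambda>i. b \<otimes> a [^] (i::int)) ` ?T"
    using S1 S2 unfolding b_coset_a unfolding generate_a by auto
  have "finite S1" "finite S2"
    using S1 S2 unfolding b_coset_a unfolding generate_a by (auto intro: finite_subset)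
  moreover have "S1 \<inter> S2 = {}"
    using S1 S2 a_pow_neq unfolding b_coset_a unfolding generate_a by fastforce
  ultimately have "(\<Sum>s\<in>S. v (x \<otimes> s)) = (\<Sum>s\<in>S1. v (x \<otimes> s)) + (\<Sum>s\<in>S2. v (x \<otimes> s))"
    unfolding S by (rule sum.union_disjoint)
  moreover have "(\<Sum>s\<in>S1. v (x \<otimes> s)) = (\<Sum>l\<in>?A. v (x \<otimes> a [^] l))"
    by (subst eq(1)) (simp only: sum.reindex[OF inj(1)] comp_def)
  moreover have "(\<Sum>s\<in>S2. v (x \<otimes> s)) = (\<Sum>t\<in>?T. v (x \<otimes> (b \<otimes> a [^] t)))"
    by (subst eq(2)) (simp only: sum.reindex[OF inj(2)] comp_def)
  ultimately show ?thesis by simp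
qed

text \<open>A function on the group is a pair of periodic functions, and its eigenvalue equation is
  evaluated separately on rotations and on reflections.\<close>

lemma cayley_eigenfunction_iff:
  assumes S: "S = S1 \<union> S2" and S1: "S1 \<subseteq> generate D {a}" and S2: "S2 \<subseteq> b <# generate D {a}"
  shows "(\<exists>v. (\<exists>x \<in> carrier D. v x \<noteq> 0) \<and> (\<forall>x \<in> carrier D. (\<Sum>s\<in>S. v (x \<otimes> s)) = k * v x)) \<longleftrightarrow>
    (\<exists>F F'. dihedral_eigenfunction n {i. i \<in> {0..<int n} \<and> a [^] i \<in> S1}
      {i. i \<in> {0..<int n} \<and> b \<otimes> a [^] i \<in> S2} k F F')"
proof -
  let ?A = "{i. i \<in> {0..<int n} \<and> a [^] i \<in> S1}"
  let ?T = "{i. i \<in> {0..<int n} \<and> b \<otimes> a [^] i \<in> S2}"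
  have cl: "a [^] (i::int) \<in> carrier D" "a [^] (i::int) \<otimes> b \<in> carrier D" for i
    using a_closed b_closed by auto
  have m1: "a [^] i \<otimes> a [^] l = a [^] (i + l)" for i l :: int
    using a_closed by (simp add: int_pow_mult)
  have m2: "a [^] i \<otimes> (b \<otimes> a [^] t) = a [^] (i - t) \<otimes> b" for i t :: int
    unfolding swap using a_closed b_closed int_pow_mult[of a i "- t"] by (simp add: m_assoc[symmetric])
  have m3: "a [^] i \<otimes> b \<otimes> a [^] l = a [^] (i - l) \<otimes> b" for i l :: int
    using m2[of i l] a_closed b_closed by (simp add: m_assoc)
  have m4: "a [^] i \<otimes> b \<otimes> (b \<otimes> a [^] t) = a [^] (i + t)" for i t :: int
  proof -
    have "a [^] i \<otimes> b \<otimes> (b \<otimes> a [^] t) = a [^] i \<otimes> (b \<otimes> b) \<otimes> a [^] t"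
      using a_closed b_closed by (simp add: m_assoc)
    then show ?thesis using a_closed by (simp add: b_mult_b m1)
  qed
  have iff: "(\<exists>x \<in> carrier D. v x \<noteq> 0) \<and> (\<forall>x \<in> carrier D. (\<Sum>s\<in>S. v (x \<otimes> s)) = k * v x) \<longleftrightarrow>
    dihedral_eigenfunction n ?A ?T k F F'"
    if F: "\<And>i. v (a [^] i) = F i" and F': "\<And>i. v (a [^] i \<otimes> b) = F' i" for v F F'
  proof -
    have ball: "(\<forall>x \<in> carrier D. P x) \<longleftrightarrow> (\<forall>i::int. P (a [^] i)) \<and> (\<forall>i::int. P (a [^] i \<otimes> b))" for P
      using cl by (metis carrier_cases)
    have bex: "(\<exists>x \<in> carrier D. v x \<noteq> 0) \<longleftrightarrow> (\<exists>i. F i \<noteq> 0 \<or> F' i \<noteq> 0)"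
      using ball[of "\<lambda>x. v x = 0"] unfolding F F' by blast
    have "F (i mod int n) = F i" "F' (i mod int n) = F' i" for i
      unfolding F[symmetric] F'[symmetric] a_pow_mod by (rule refl)+
    then show ?thesis
      unfolding bex ball dihedral_eigenfunction_def cayley_sum[OF assms cl(1)] cayley_sum[OF assms cl(2)]
        m1 m2 m3 m4 F F' by blast
  qed
  show ?thesis
  proof
    assume "\<exists>v. (\<exists>x \<in> carrier D. v x \<noteq> 0) \<and> (\<forall>x \<in> carrier D. (\<Sum>s\<in>S. v (x \<otimes> s)) = k * v x)"
    then obtain v where "(\<exists>x \<in> carrier D. v x \<noteq> 0) \<and> (\<forall>x \<in> carrier D. (\<Sum>s\<in>S. v (x \<otimes> s)) = k * v x)" ..
    then show "\<exists>F F'. dihedral_eigenfunction n ?A ?T k F F'"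
      using iff[of v "\<lambda>i. v (a [^] i)" "\<lambda>i. v (a [^] i \<otimes> b)"] by blast
  next
    assume "\<exists>F F'. dihedral_eigenfunction n ?A ?T k F F'"
    then obtain F F' where FF: "dihedral_eigenfunction n ?A ?T k F F'" by blast
    then have "\<And>i. F (i mod int n) = F i" "\<And>i. F' (i mod int n) = F' i"
      unfolding dihedral_eigenfunction_def by blast+
    then obtain v where "\<And>i. v (a [^] i) = F i" "\<And>i. v (a [^] i \<otimes> b) = F' i"
      using carrier_function[of F F'] by blast
    then show "\<exists>v. (\<exists>x \<in> carrier D. v x \<noteq> 0) \<and> (\<forall>x \<in> carrier D. (\<Sum>s\<in>S. v (x \<otimes> s)) = k * v x)"
      using iff[of v F F'] FF by blast
  qed
qed

lemma integral_cayley_graph_dihedral_iff: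
  assumes S: "S = S1 \<union> S2" and inv: "S = m_inv D ` S"
    and S1: "S1 \<subseteq> generate D {a}" and S2: "S2 \<subseteq> b <# generate D {a}"
  defines "A \<equiv> {i. i \<in> {0..<int n} \<and> a [^] i \<in> S1}"
    and "T \<equiv> {i. i \<in> {0..<int n} \<and> b \<otimes> a [^] i \<in> S2}"
  shows "integral_graph (cayley_graph D S) \<longleftrightarrow>
    (\<forall>j. (\<Sum>l\<in>A. root_char n (j * l)) + of_real (norm (\<Sum>t\<in>T. root_char n (j * t))) \<in> \<int> \<and>
      (\<Sum>l\<in>A. root_char n (j * l)) - of_real (norm (\<Sum>t\<in>T. root_char n (j * t))) \<in> \<int>)"
    (is "_ \<longleftrightarrow> (\<forall>j. ?c j + ?r j \<in> \<int> \<and> ?c j - ?r j \<in> \<int>)")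
proof -
  have sub: "S \<subseteq> carrier D"
    using S1 S2 a_closed b_closed unfolding S b_coset_a unfolding generate_a by auto
  have fin: "finite (carrier D)"
    using card_carrier n_pos by (intro card_ge_0_finite) simp
  have A: "A \<subseteq> {0..<int n}" by (auto simp: A_def)
  \<comment> \<open>The inverse of a rotation is a rotation and so cannot lie in \<open>S2\<close>;
    closure of \<open>S\<close> under inverses therefore restricts to \<open>S1\<close>.\<close>
  have sym: "(- l) mod int n \<in> A" if "l \<in> A" for l
  proof -
    have "a [^] l \<in> S" using that S by (simp add: A_def)
    then have "inv (a [^] l) \<in> S" by (subst inv) (rule imageI)
    then have "a [^] ((- l) mod int n) \<in> S"
      using a_closed by (simp only: a_pow_mod int_pow_neg)
    moreover have "a [^] ((- l) mod int n) \<notin> S2"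
      using S2 a_pow_neq unfolding b_coset_a by blast
    ultimately show ?thesis using S n_pos by (simp add: A_def)
  qed
  have "integral_graph (cayley_graph D S) \<longleftrightarrow>
    (\<forall>k. (\<exists>F G. dihedral_eigenfunction n A T k F G) \<longrightarrow> k \<in> \<int>)"
    unfolding integral_cayley_graph_iff[OF sub fin] cayley_eigenfunction_iff[OF S S1 S2] A_def T_def ..
  also have "\<dots> \<longleftrightarrow> (\<forall>j. ?c j + ?r j \<in> \<int> \<and> ?c j - ?r j \<in> \<int>)"
  proof (intro iffI allI impI)
    fix j assume *: "\<forall>k. (\<exists>F G. dihedral_eigenfunction n A T k F G) \<longrightarrow> k \<in> \<int>"
    have "?c j + 1 * ?r j \<in> \<int>" "?c j + (- 1) * ?r j \<in> \<int>"
      using * dihedral_eigenfunction_character[OF n_pos A sym, of 1 T j]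
        dihedral_eigenfunction_character[OF n_pos A sym, of "- 1" T j] by blast+
    then show "?c j + ?r j \<in> \<int> \<and> ?c j - ?r j \<in> \<int>" by simp
  next
    fix k assume "\<forall>j. ?c j + ?r j \<in> \<int> \<and> ?c j - ?r j \<in> \<int>" "\<exists>F G. dihedral_eigenfunction n A T k F G"
    then show "k \<in> \<int>"
      using dihedral_eigenfunction_eigenvalue[OF n_pos A sym] by metis
  qed
  finally show ?thesis .
qed

end

end

section \<open>The characterization of integrality\<close>

theorem theorem4p1:
  fixes D :: "('g, 'm) monoid_scheme" (structure)
    and n :: nat and a b :: 'g and S S1 S2 :: "'g set"
  assumes "n > 0" and "\<forall>p \<in> prime_factors n. 3 \<le> p"
    and "dihedral_group D n a b"
    and "S = S1 \<union> S2" and "S \<subseteq> carrier D - {\<one>}" and "S = m_inv D ` S"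
    and "S1 \<subseteq> generate D {a}" and "S2 \<subseteq> b <# generate D {a}"
    and "two_integral D n a S2"
  shows "integral_graph (cayley_graph D S) \<longleftrightarrow>
    S1 \<in> subgroup_algebra D a \<and>
    (\<exists>p \<in> prime_factors n. \<exists>k j. k \<le> p - 1 \<and> j \<le> n div p - 1 \<and>
      (S2 = ((b \<otimes> a [^] j) <# generate D {a [^] (n div p)}) - {b \<otimes> a [^] (k * (n div p) + j)} \<or>
       S2 = (b \<otimes> a [^] j) <# generate D {a [^] (n div p)}))"
proof -
  interpret dihedral_group D n a b by fact
  note n = \<open>n > 0\<close>
  let ?g = "\<lambda>i. b \<otimes> a [^] (i::int)"
  define A where "A = {i \<in> {0..<int n}. a [^] i \<in> S1}"
  define T where "T = {i \<in> {0..<int n}. ?g i \<in> S2}"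
  have A: "A \<subseteq> {0..<int n}" by (auto simp: A_def)
  have S2_eq: "S2 = ?g ` T"
    using assms(8) unfolding b_coset_a[OF n] T_def by auto
  have inj_g: "inj_on ?g {0..<int n}"
    by (rule inj_onI) (simp add: b_a_pow_eq_iff[OF n])
  have image_eq_iff: "?g ` X = ?g ` Y \<longleftrightarrow> X = Y" if "X \<subseteq> {0..<int n}" "Y \<subseteq> {0..<int n}" for X Y
    using inj_on_image_eq_iff[OF inj_g that] .
  obtain d m where "uniform_differences n d m T"
    using two_integral_uniform_differences[OF n assms(8,9)] unfolding T_def by blast
  then interpret uniform_differences n d m T .
  have odd: "odd n"
  proof
    assume "even n"
    then have "2 \<in> prime_factors n" using n by (simp add: prime_factors_dvd)
    then show False using assms(2) by fastforce
  qed
  have algebra: "S1 \<in> subgroup_algebra D a \<longleftrightarrow>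
    (\<forall>l \<in> A. \<forall>l' \<in> {0..<int n}. gcd l (int n) = gcd l' (int n) \<longrightarrow> l' \<in> A)"
    unfolding A_def by (rule subgroup_algebra_iff_gcd_closed[OF n assms(7)])
  have spectrum: "integral_graph (cayley_graph D S) \<longleftrightarrow>
    (\<forall>j. (\<Sum>l\<in>A. root_char n (j * l)) + of_real (norm (\<Sum>t\<in>T. root_char n (j * t))) \<in> \<int> \<and>
      (\<Sum>l\<in>A. root_char n (j * l)) - of_real (norm (\<Sum>t\<in>T. root_char n (j * t))) \<in> \<int>)"
    using integral_cayley_graph_dihedral_iff[OF n assms(4,6,7,8)] unfolding A_def T_def by simp
  show ?thesis
  proof
    assume "integral_graph (cayley_graph D S)"
    then have ints: "(\<Sum>l\<in>A. root_char n (j * l)) + of_real (norm (\<Sum>t\<in>T. root_char n (j * t))) \<in> \<int>"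
      "(\<Sum>l\<in>A. root_char n (j * l)) - of_real (norm (\<Sum>t\<in>T. root_char n (j * t))) \<in> \<int>" for j
      using spectrum by blast+
    \<comment> \<open>Adding the two eigenvalues at one frequency isolates twice the contribution of
      the rotations.\<close>
    have "2 * c \<in> \<int>" if "c + r \<in> \<int>" "c - r \<in> \<int>" for c r :: complex
      using Ints_add[OF that] by simp
    then have "2 * (\<Sum>l\<in>A. root_char n (j * l)) \<in> \<int>" for j
      using ints by blast
    then have closed: "\<And>l l'. l \<in> A \<Longrightarrow> l' \<in> {0..<int n} \<Longrightarrow> gcd l (int n) = gcd l' (int n) \<Longrightarrow> l' \<in> A"
      using integral_fourier_imp_gcd_closed[OF n A] by blast
    \<comment> \<open>Closure under equal gcd removes the factor 2: the contribution of the
      rotations is itself an integer. Subtracting it at frequency 1 leaves the norm needed for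
      \<open>prime_quotient\<close> and \<open>residue_class\<close>.\<close>
    have "(\<Sum>l\<in>A. root_char n (1 * l)) \<in> \<int>"
      by (rule gcd_closed_imp_integral_fourier[OF n A closed])
    then have "complex_of_real (norm (\<Sum>t\<in>T. root_char n t)) \<in> \<int>"
      using Ints_diff[OF ints(1)[of 1], of "\<Sum>l\<in>A. root_char n (1 * l)"] by simp
    then obtain z where "complex_of_real (norm (\<Sum>t\<in>T. root_char n t)) = of_int z"
      by (auto elim: Ints_cases)
    then have z: "norm (\<Sum>t\<in>T. root_char n t) = of_int z"
      by (metis of_real_eq_iff of_real_of_int_eq)
    then have "0 \<le> z" by (metis norm_ge_zero of_int_0_le_iff)
    then have s: "norm (\<Sum>t\<in>T. root_char n t) = of_nat (nat z)" using z by simp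
    have p: "prime (n div d)" by (rule prime_quotient[OF odd s])
    obtain c r where cr: "T = {r \<in> {0..<int n}. int d dvd r - c} \<or>
      T = {r \<in> {0..<int n}. int d dvd r - c} - {r} \<and> r \<in> {r \<in> {0..<int n}. int d dvd r - c}"
      by (rule residue_class[OF odd s])
    \<comment> \<open>The least nonnegative representative of the class modulo \<open>d\<close>. For
      the prime \<open>n div d\<close> the bound on \<open>j\<close> in the statement is
      \<open>d - 1\<close>, by \<open>ndp\<close> below.\<close>
    define j where "j = nat (c mod int d)"
    have j: "int j = c mod int d" using d_pos by (simp add: j_def)
    have "int d dvd r - c \<longleftrightarrow> int d dvd r - int j" for r
      unfolding mod_eq_dvd_iff[symmetric] j by simp
    then have cr': "T = {r \<in> {0..<int n}. int d dvd r - int j} \<or>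
      T = {r \<in> {0..<int n}. int d dvd r - int j} - {r} \<and> r \<in> {r \<in> {0..<int n}. int d dvd r - int j}"
      using cr by simp
    let ?C = "{r \<in> {0..<int n}. int d dvd r - int j}"
    have ndp: "n div (n div d) = d"
      using n_eq n_pos by (metis div_mult_self_is_m mult.commute nat_0_less_mult_iff n)
    have pf: "n div d \<in> prime_factors n"
      using p n n_eq by (metis dvd_triv_right prime_factors_dvd mem_Collect_eq not_gr0 prime_factorsI)
    have "int j < int d" using d_pos by (simp add: j)
    then have jd: "j \<le> d - 1" by linarith
    have coset: "(b \<otimes> a [^] j) <# generate D {a [^] d} = ?g ` ?C"
      by (rule b_a_pow_coset[OF n d_dvd])
    have "\<exists>k. k \<le> n div d - 1 \<and>
      (S2 = ((b \<otimes> a [^] j) <# generate D {a [^] d}) - {b \<otimes> a [^] (k * d + j)} \<or>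
       S2 = (b \<otimes> a [^] j) <# generate D {a [^] d})"
      using cr'
    proof
      assume "T = ?C"
      \<comment> \<open>No point is removed, so any admissible \<open>k\<close> serves.\<close>
      then show ?thesis using S2_eq coset by (intro exI[of _ 0]) simp
    next
      assume T: "T = ?C - {r} \<and> r \<in> ?C"
      \<comment> \<open>The removed exponent \<open>r\<close> has remainder \<open>j\<close> modulo
        \<open>d\<close>, so its quotient by \<open>d\<close> is the required
        \<open>k\<close>.\<close>
      define k where "k = nat r div d"
      have r: "0 \<le> r" "r < int n" "int d dvd r - int j" using T by auto
      have "r mod int d = int j"
        using r(3) unfolding mod_eq_dvd_iff[symmetric] j by simp
      then have "nat r mod d = j" using r(1) by (metis int_nat_eq nat_int zmod_int)
      then have kr: "k * d + j = nat r" unfolding k_def by (metis div_mult_mod_eq)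
      have "k * d < (n div d) * d" using kr r n_eq by (metis add_leD1 le_less_trans mult.commute nat_less_iff order_refl)
      then have "k < n div d" by simp
      then have "k \<le> n div d - 1" by linarith
      moreover have "?g ` (?C - {r}) = ?g ` ?C - ?g ` {r}"
        using r by (intro inj_on_image_set_diff[OF inj_g]) auto
      then have "S2 = ?g ` ?C - {?g r}"
        using S2_eq T by simp
      moreover have "?g r = b \<otimes> a [^] (k * d + j)"
        using r(1) int_pow_int[of D a "nat r"] unfolding kr by simp
      ultimately show ?thesis using coset by metis
    qed
    then show "S1 \<in> subgroup_algebra D a \<and>
      (\<exists>p \<in> prime_factors n. \<exists>k j. k \<le> p - 1 \<and> j \<le> n div p - 1 \<and>
        (S2 = ((b \<otimes> a [^] j) <# generate D {a [^] (n div p)}) - {b \<otimes> a [^] (k * (n div p) + j)} \<or>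
         S2 = (b \<otimes> a [^] j) <# generate D {a [^] (n div p)}))"
      using algebra closed pf jd ndp by (metis (no_types, lifting))
  next
    assume "S1 \<in> subgroup_algebra D a \<and>
      (\<exists>p \<in> prime_factors n. \<exists>k j. k \<le> p - 1 \<and> j \<le> n div p - 1 \<and>
        (S2 = ((b \<otimes> a [^] j) <# generate D {a [^] (n div p)}) - {b \<otimes> a [^] (k * (n div p) + j)} \<or>
         S2 = (b \<otimes> a [^] j) <# generate D {a [^] (n div p)}))"
    then obtain p k j where alg: "S1 \<in> subgroup_algebra D a" and p: "p \<in> prime_factors n"
      and k: "k \<le> p - 1" and j: "j \<le> n div p - 1" and
      S2: "S2 = ((b \<otimes> a [^] j) <# generate D {a [^] (n div p)}) - {b \<otimes> a [^] (k * (n div p) + j)} \<or>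
         S2 = (b \<otimes> a [^] j) <# generate D {a [^] (n div p)}"
      by blast
    define e where "e = n div p"
    have n_ep: "n = e * p" using p by (auto simp: e_def prime_factors_dvd)
    then have e_dvd: "e dvd n" by simp
    have e0: "e > 0" and p0: "p > 0" using n n_ep by (auto intro!: Nat.gr0I)
    let ?C = "{r \<in> {0..<int n}. int e dvd r - int j}"
    let ?r = "int (k * e + j)"
    have coset: "(b \<otimes> a [^] j) <# generate D {a [^] e} = ?g ` ?C"
      by (rule b_a_pow_coset[OF n e_dvd])
    \<comment> \<open>The bounds on \<open>k\<close> and \<open>j\<close> make the removed exponent
      its own representative in \<open>{0..<int n}\<close>.\<close>
    have "k * e + j < e * p"
    proof -
      have "k * e + j < (k + 1) * e" using j e0 by (simp add: e_def[symmetric])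
      also have "\<dots> \<le> p * e" using k p0 by (intro mult_le_mono1) simp
      finally show ?thesis by (simp add: mult.commute)
    qed
    then have "?r < int n" using n_ep by (simp only: of_nat_less_iff)
    then have rC: "?r \<in> ?C" by simp
    have "T = ?C \<or> T = ?C - {?r} \<and> ?r \<in> ?C"
      using S2
    proof
      assume "S2 = (b \<otimes> a [^] j) <# generate D {a [^] (n div p)}"
      then have "?g ` T = ?g ` ?C" using coset S2_eq by (simp add: e_def)
      then have "T = ?C" by (subst (asm) image_eq_iff) (use T_subset in auto)
      then show ?thesis ..
    next
      assume "S2 = ((b \<otimes> a [^] j) <# generate D {a [^] (n div p)}) - {b \<otimes> a [^] (k * (n div p) + j)}"
      then have "?g ` T = ?g ` ?C - {?g ?r}"
        using coset S2_eq int_pow_int[of D a "k * e + j"] by (simp add: e_def)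
      also have "\<dots> = ?g ` (?C - {?r})"
      proof -
        have "?g ` (?C - {?r}) = ?g ` ?C - ?g ` {?r}"
          using rC by (intro inj_on_image_set_diff[OF inj_g]) auto
        then show ?thesis by simp
      qed
      finally have "T = ?C - {?r}" by (subst (asm) image_eq_iff) (use T_subset in auto)
      then show ?thesis using rC by blast
    qed
    then have "norm (\<Sum>t\<in>T. root_char n (j' * t)) \<in> \<int>" for j'
      by (rule residue_class_fourier_norm[OF n n_ep])
    then have "complex_of_real (norm (\<Sum>t\<in>T. root_char n (j' * t))) \<in> \<int>" for j'
      by (metis Ints_cases Ints_of_int of_real_of_int_eq)
    moreover have "(\<Sum>l\<in>A. root_char n (j' * l)) \<in> \<int>" for j'
      using algebra alg by (intro gcd_closed_imp_integral_fourier[OF n A]) blast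
    ultimately show "integral_graph (cayley_graph D S)"
      unfolding spectrum by (auto intro: Ints_add Ints_diff)
  qed
qed

end
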